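(* Let $n\in\mathbb{N}$ with $n\geq4$. Then $$\Delta_n = -\frac{4G}{\pi(n-2)(n-1)} + \frac{n-2}{n-1}\Delta_{n-2} + \frac{1}{(n-2)(n-1)}\sum_{k=1}^{n-3} \int_0^1\int_0^1\frac{\Gamma\left(\frac{a+b+k}{2}\right)}{k!}\left[\sum_{j=0}^{k-1}\frac{2^{j-1}(k-j-1)!}{\Gamma\left(\frac{a+b+k-2j}{2}\right)}+\frac{2^{k}}{4\,\Gamma\left(\frac{a+b-k}{2}\right)}\left(\psi\left(\frac{a+b-k}{4}\right)- \psi\left(\frac{a+ b - k + 2}{4}\right)\right)\right] da\, db.$$
   Context: For $n\in\mathbb{N}=\{1,2,\ldots\}$, $\Delta_n := \int_0^\infty \ln x\,\operatorname{sech}^n x \, dx$. $G=\sum_{k\ge0}(-1)^k/(2k+1)^2$ is Catalan's constant, and $\psi=\Gamma'/\Gamma$ is the digamma function. The reciprocal $1/\Gamma$ is the entire function (zero at the poles of $\Gamma$); where $\psi$ has a pole (a null set of $(a,b)$) the integrand is understood by its continuous extension. *)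

theory Defs
  imports "HOL-Analysis.Analysis"
begin

definition sech :: "real \<Rightarrow> real" where
  "sech x = 1 / cosh x"

definition Delta :: "nat \<Rightarrow> real" where
  "Delta n = (LBINT x=0..\<infinity>. ln x * sech x ^ n)"

definition Catalan_G :: real where
  "Catalan_G = (\<Sum>k. (-1) ^ k / (2 * real k + 1)\<^sup>2)"

definition digamma_dom :: "nat \<Rightarrow> (real \<times> real) set" where
  "digamma_dom k = {(a, b). (a + b - real k) / 4 \<notin> \<int>\<^sub>\<le>\<^sub>0 \<and> (a + b - real k + 2) / 4 \<notin> \<int>\<^sub>\<le>\<^sub>0}"

text \<open>
  The exponent of \<open>2 powi (int j - 1)\<close> is \<open>-1\<close> for \<open>j = 0\<close>. The natural number subtraction
  in \<open>fact (k - j - 1)\<close> does not truncate, as \<open>j < k\<close>. Outside \<^term>\<open>digamma_dom k\<close>,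
  the values of \<^const>\<open>Digamma\<close> are meaningless and \<open>integrand_ext k\<close> is used instead.
\<close>

definition integrand :: "nat \<Rightarrow> real \<times> real \<Rightarrow> real" where
  "integrand k = (\<lambda>(a, b).
     Gamma ((a + b + real k) / 2) / fact k *
       ((\<Sum>j<k. 2 powi (int j - 1) * fact (k - j - 1) * rGamma ((a + b + real k - 2 * real j) / 2))
        + 2 ^ k / 4 * rGamma ((a + b - real k) / 2) *
            (Digamma ((a + b - real k) / 4) - Digamma ((a + b - real k + 2) / 4))))"

text \<open>
  The continuous extension to the poles of the digamma terms. The limit is taken within
  \<^term>\<open>digamma_dom k\<close> because these poles are not isolated points of the plane but fill lines
  on which \<open>a + b\<close> is constant.
\<close>

definition integrand_ext :: "nat \<Rightarrow> real \<times> real \<Rightarrow> real" where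
  "integrand_ext k p =
     (if p \<in> digamma_dom k then integrand k p
      else Lim (at p within digamma_dom k) (integrand k))"

end

theory Submission
  imports Defs "HOL-Real_Asymp.Real_Asymp"
begin

text \<open>
  The second derivative of \<open>sech^m\<close> is \<open>m\<^sup>2 sech^m - m (m + 1) sech^(m + 2)\<close>. Integrating it against the
  logarithm and moving both derivatives over by parts (\<open>Delta_recurrence\<close>) shows, for \<open>m = n - 2\<close>, that
  \<open>m\<^sup>2 Delta m - m (m + 1) Delta (m + 2)\<close> equals the integral of \<open>(1 - sech^m) / x\<^sup>2\<close> over the positive half-line.
  This integrand telescopes into the sum over \<open>k < m\<close> of the kernels \<open>sech^(k + 1) (cosh x - 1) / x\<^sup>2\<close>, so the
  theorem amounts to evaluating the integral of each kernel.

  For \<open>k \<ge> 1\<close>, the quotient \<open>(cosh x - 1) / x\<^sup>2\<close> is half the average of \<open>exp (- (a + b - 1) x)\<close> over the unit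
  square. By Tonelli's theorem the kernel integrates to half the average over \<open>a\<close> and \<open>b\<close> of the
  exponential moments of \<open>sech^(k + 1)\<close>. Such a moment is, up to a power of 2, the integral of
  \<open>t powr (p - 1) / (1 + t)^(k + 1)\<close> over \<open>[0, 1]\<close> with \<open>p = (a + b + k) / 2\<close>. This function of \<open>k\<close> and \<open>p\<close>
  satisfies two recursions. One keeps \<open>p\<close> fixed and identifies it with the moments
  (\<open>has_bochner_integral_sech_power\<close>). The other lowers \<open>k\<close> and \<open>p\<close> together and unrolls to the expression in
  Gamma and digamma values (\<open>beta_k_closed_form\<close>). Unrolling leaves the domain where the integral converges,
  so the function is introduced through the first recursion, starting from a digamma difference that makes sense
  at negative arguments as well.

  For \<open>k = 0\<close>, Taylor's formula and the reflection formula of the digamma function reduce the kernel integral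
  to an elementary integral over \<open>(0, 1)\<close>. A tangent substitution turns that into \<open>4 / pi\<close> times the integral of
  \<open>arctan t / t\<close>, and hence into \<open>4 G / pi\<close> (\<open>has_bochner_integral_sech_sq_kernel_0\<close>).

  The poles of the digamma terms lie on lines where \<open>a + b\<close> is an integer. For each \<open>b\<close> they meet only countably
  many \<open>a\<close>, so they are invisible to the iterated integral (\<open>LBINT_integrand_ext\<close>).
\<close>

section \<open>Calculus on the half-line and the unit interval\<close>

lemma einterval_0_inf: "einterval 0 \<infinity> = {0<..}"
  by (auto simp: einterval_def)

lemma einterval_0_1: "einterval 0 1 = {0<..<1}"
  by (auto simp: einterval_def)

lemma tendsto_at_right_cont:
  fixes F :: "real \<Rightarrow> real"
  shows "isCont F a \<Longrightarrow> (F \<longlongrightarrow> F a) (at_right a)"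
  unfolding isCont_def by (rule filterlim_mono) (auto intro: at_le)

lemma tendsto_at_left_cont:
  fixes F :: "real \<Rightarrow> real"
  shows "isCont F a \<Longrightarrow> (F \<longlongrightarrow> F a) (at_left a)"
  unfolding isCont_def by (rule filterlim_mono) (auto intro: at_le)

text \<open>
  The fundamental theorem of calculus on open intervals, phrased with indicator functions: in this
  form an antiderivative yields integrability and the value at once, and passing to
  nonnegative integrals for Tonelli's theorem is a single step.
\<close>

lemma has_bochner_integral_FTC_Ioi_nonneg:
  fixes f F :: "real \<Rightarrow> real"
  assumes F: "\<And>x. x > 0 \<Longrightarrow> (F has_real_derivative f x) (at x)"
    and f: "\<And>x. x > 0 \<Longrightarrow> isCont f x" "\<And>x. x > 0 \<Longrightarrow> f x \<ge> 0"
    and A: "(F \<longlongrightarrow> A) (at_right 0)" and B: "(F \<longlongrightarrow> B) at_top"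
  shows "has_bochner_integral lborel (\<lambda>x. indicator {0<..} x * f x) (B - A)"
proof -
  have A': "((F \<circ> real_of_ereal) \<longlongrightarrow> A) (at_right 0)"
    using A unfolding zero_ereal_def by (simp add: ereal_tendsto_simps)
  have B': "((F \<circ> real_of_ereal) \<longlongrightarrow> B) (at_left \<infinity>)"
    using B by (simp add: ereal_tendsto_simps)
  have "set_integrable lborel (einterval 0 \<infinity>) f" "(LBINT x=0..\<infinity>. f x) = B - A"
    by (rule interval_integral_FTC_nonneg[OF _ _ _ _ A' B']; use F f in auto)+
  thus ?thesis
    by (simp add: einterval_0_inf set_integrable_def interval_lebesgue_integral_def
        set_lebesgue_integral_def has_bochner_integral_iff)
qed

lemma has_bochner_integral_FTC_01_nonneg:
  fixes f F :: "real \<Rightarrow> real"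
  assumes F: "\<And>x. 0 < x \<Longrightarrow> x < 1 \<Longrightarrow> (F has_real_derivative f x) (at x)"
    and f: "\<And>x. 0 < x \<Longrightarrow> x < 1 \<Longrightarrow> isCont f x" "\<And>x. 0 < x \<Longrightarrow> x < 1 \<Longrightarrow> f x \<ge> 0"
    and A: "(F \<longlongrightarrow> A) (at_right 0)" and B: "(F \<longlongrightarrow> B) (at_left 1)"
  shows "has_bochner_integral lborel (\<lambda>x. indicator {0<..<1} x * f x) (B - A)"
proof -
  have A': "((F \<circ> real_of_ereal) \<longlongrightarrow> A) (at_right 0)"
    using A unfolding zero_ereal_def by (simp add: ereal_tendsto_simps)
  have B': "((F \<circ> real_of_ereal) \<longlongrightarrow> B) (at_left 1)"
    using B unfolding one_ereal_def by (simp add: ereal_tendsto_simps)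
  have "set_integrable lborel (einterval 0 1) f" "(LBINT x=0..1. f x) = B - A"
    by (rule interval_integral_FTC_nonneg[OF _ _ _ _ A' B']; use F f in auto)+
  thus ?thesis
    by (simp add: einterval_0_1 set_integrable_def interval_lebesgue_integral_def
        set_lebesgue_integral_def has_bochner_integral_iff)
qed

lemma integral_FTC_Ioi:
  fixes f F :: "real \<Rightarrow> real"
  assumes F: "\<And>x. x > 0 \<Longrightarrow> (F has_real_derivative f x) (at x)"
    and f: "\<And>x. x > 0 \<Longrightarrow> isCont f x"
    and int: "integrable lborel (\<lambda>x. indicator {0<..} x * f x)"
    and A: "(F \<longlongrightarrow> A) (at_right 0)" and B: "(F \<longlongrightarrow> B) at_top"
  shows "(\<integral>x. indicator {0<..} x * f x \<partial>lborel) = B - A"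
proof -
  have A': "((F \<circ> real_of_ereal) \<longlongrightarrow> A) (at_right 0)"
    using A unfolding zero_ereal_def by (simp add: ereal_tendsto_simps)
  have B': "((F \<circ> real_of_ereal) \<longlongrightarrow> B) (at_left \<infinity>)"
    using B by (simp add: ereal_tendsto_simps)
  have "(LBINT x=0..\<infinity>. f x) = B - A"
    by (rule interval_integral_FTC_integrable[OF _ _ _ _ A' B'])
       (use F f int in \<open>auto simp: einterval_0_inf set_integrable_def
          has_real_derivative_iff_has_vector_derivative\<close>)
  thus ?thesis
    by (simp add: einterval_0_inf interval_lebesgue_integral_def set_lebesgue_integral_def)
qed

lemma LBINT_unit_square:
  fixes f :: "real \<Rightarrow> real \<Rightarrow> real"
  shows "(LBINT b=0..1. (LBINT a=0..1. f a b)) =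
    (\<integral>b. (\<integral>a. indicator {0<..<1} b * indicator {0<..<1} a * f a b \<partial>lborel) \<partial>lborel)"
  by (simp add: einterval_0_1 interval_lebesgue_integral_def set_lebesgue_integral_def mult.assoc)

section \<open>Nielsen's beta function and its higher analogues\<close>

text \<open>
  For \<open>z > 0\<close> this is Nielsen's beta function \<open>\<Sum>n. (-1)^n / (n + z)\<close>, equivalently
  \<open>\<integral>t in 0..1. t powr (z - 1) / (1 + t)\<close>; the digamma form continues it to negative arguments.
\<close>

definition alt_beta :: "real \<Rightarrow> real" where
  "alt_beta z = (Digamma ((z + 1) / 2) - Digamma (z / 2)) / 2"

lemma alt_beta_plus1:
  assumes "z \<noteq> 0"
  shows "alt_beta (z + 1) = 1 / z - alt_beta z"
proof -
  have "Digamma (z / 2 + 1) = Digamma (z / 2) + 1 / (z / 2)"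
    using assms by (intro Digamma_plus1) auto
  moreover have "(z + 1 + 1) / 2 = z / 2 + 1" by simp
  ultimately show ?thesis by (simp add: alt_beta_def diff_divide_distrib add_divide_distrib add_ac)
qed

text \<open>
  Consecutive terms of the alternating series are paired, so all terms are positive. It is the
  difference of the two digamma series, in which the normalising terms cancel.
\<close>

lemma alt_beta_sums:
  assumes "z > 0"
  shows "(\<lambda>n. 1 / (2 * real n + z) - 1 / (2 * real n + z + 1)) sums alt_beta z"
proof -
  have D: "(\<lambda>n. inverse (real (Suc n)) - inverse (w + real n)) sums (Digamma w + euler_mascheroni)"
    if "w \<noteq> 0" for w :: real
    using summable_Digamma[OF that] by (simp add: Digamma_def summable_sums)
  have "(\<lambda>n. ((inverse (real (Suc n)) - inverse ((z + 1) / 2 + real n))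
         - (inverse (real (Suc n)) - inverse (z / 2 + real n))) / 2) sums
        (((Digamma ((z + 1) / 2) + euler_mascheroni) - (Digamma (z / 2) + euler_mascheroni)) / 2)"
    using assms by (intro sums_divide sums_diff D) auto
  also have "(\<lambda>n. ((inverse (real (Suc n)) - inverse ((z + 1) / 2 + real n))
         - (inverse (real (Suc n)) - inverse (z / 2 + real n))) / 2) =
      (\<lambda>n. 1 / (2 * real n + z) - 1 / (2 * real n + z + 1))"
  proof
    fix n
    have "inverse ((z + 1) / 2 + real n) = 2 * (1 / (2 * real n + z + 1))"
      "inverse (z / 2 + real n) = 2 * (1 / (2 * real n + z))"
      using assms by (auto simp: divide_simps)
    thus "((inverse (real (Suc n)) - inverse ((z + 1) / 2 + real n))
         - (inverse (real (Suc n)) - inverse (z / 2 + real n))) / 2 =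
      1 / (2 * real n + z) - 1 / (2 * real n + z + 1)" by simp
  qed
  finally show ?thesis by (simp add: alt_beta_def)
qed

lemma Digamma_reflection:
  fixes z :: real
  assumes z: "0 < z" "z < 1"
  shows "Digamma (1 - z) - Digamma z = pi * cos (pi * z) / sin (pi * z)"
proof -
  have refl: "rGamma x * rGamma (1 - x) = sin (pi * x) / pi" for x :: real
  proof -
    have eq: "1 - complex_of_real x = complex_of_real (1 - x)"
      "complex_of_real pi * complex_of_real x = complex_of_real (pi * x)"
      by (simp_all only: of_real_diff of_real_1 of_real_mult)
    have "complex_of_real (rGamma x * rGamma (1 - x)) = complex_of_real (sin (pi * x) / pi)"
      using rGamma_reflection_complex[of "complex_of_real x"]
      unfolding eq sin_of_real rGamma_complex_of_real unfolding of_real_mult of_real_divide .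
    thus ?thesis unfolding of_real_eq_iff .
  qed
  have nz: "z \<notin> \<int>\<^sub>\<le>\<^sub>0" "1 - z \<notin> \<int>\<^sub>\<le>\<^sub>0" using z by (auto dest: nonpos_Ints_nonpos)
  \<comment> \<open>Both sides of the reflection formula of the Gamma function are differentiated.\<close>
  have "((\<lambda>x. rGamma x * rGamma (1 - x)) has_real_derivative
      rGamma z * rGamma (1 - z) * (Digamma (1 - z) - Digamma z)) (at z)"
  proof -
    have 1: "(rGamma has_real_derivative - rGamma z * Digamma z) (at z)"
      using has_field_derivative_rGamma_no_nonpos_int[OF nz(1)] .
    have 2: "(rGamma has_real_derivative - rGamma (1 - z) * Digamma (1 - z)) (at (1 - z))"
      using has_field_derivative_rGamma_no_nonpos_int[OF nz(2)] .
    have 3: "((\<lambda>x. 1 - x) has_real_derivative -1) (at z)"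
      by (auto intro!: derivative_eq_intros)
    show ?thesis
      using DERIV_mult[OF 1 DERIV_chain2[OF 2 3]] by (simp add: algebra_simps)
  qed
  moreover have "((\<lambda>x. sin (pi * x) / pi) has_real_derivative cos (pi * z)) (at z)"
    by (auto intro!: derivative_eq_intros)
  ultimately have "rGamma z * rGamma (1 - z) * (Digamma (1 - z) - Digamma z) = cos (pi * z)"
    unfolding refl by (rule DERIV_unique)
  moreover have "sin (pi * z) > 0" using z by (intro sin_gt_zero) auto
  ultimately show ?thesis unfolding refl by (simp add: field_simps)
qed

text \<open>
  The digamma reflection formula at \<open>z / 2\<close> and at \<open>(1 - z) / 2\<close> gives a cotangent and a
  tangent of the same angle, whose sum is a cosecant of the doubled angle.
\<close>

lemma alt_beta_reflection:
  assumes z: "0 < z" "z < 1"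
  shows "alt_beta z + alt_beta (1 - z) = pi / sin (pi * z)"
proof -
  have s: "sin (pi * (z / 2)) > 0" "cos (pi * (z / 2)) > 0"
    using z by (auto intro!: sin_gt_zero cos_gt_zero)
  have "Digamma (1 - z / 2) - Digamma (z / 2) = pi * cos (pi * (z / 2)) / sin (pi * (z / 2))"
    using z by (intro Digamma_reflection) auto
  \<comment> \<open>At the second point the cotangent turns into a tangent, as the angles are complementary.\<close>
  moreover have "Digamma (1 - (1 - z) / 2) - Digamma ((1 - z) / 2) =
      pi * cos (pi * ((1 - z) / 2)) / sin (pi * ((1 - z) / 2))"
    using z by (intro Digamma_reflection) auto
  moreover have "pi * ((1 - z) / 2) = pi / 2 - pi * (z / 2)" by (simp add: field_simps)
  moreover have "1 - (1 - z) / 2 = (z + 1) / 2" "(1 - z + 1) / 2 = 1 - z / 2" by (simp_all add: field_simps)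
  moreover have "cos (pi / 2 - pi * (z / 2)) = sin (pi * (z / 2))" "sin (pi / 2 - pi * (z / 2)) = cos (pi * (z / 2))"
    by (simp_all add: sin_diff cos_diff)
  moreover have "2 * (alt_beta z + alt_beta (1 - z)) = (Digamma (1 - z / 2) - Digamma (z / 2)) +
     (Digamma ((z + 1) / 2) - Digamma ((1 - z) / 2))"
    unfolding alt_beta_def \<open>(1 - z + 1) / 2 = 1 - z / 2\<close> by argo
  ultimately have "2 * (alt_beta z + alt_beta (1 - z)) =
     pi * cos (pi * (z / 2)) / sin (pi * (z / 2)) + pi * sin (pi * (z / 2)) / cos (pi * (z / 2))"
    by (simp only:)
  also have "\<dots> = pi * ((sin (pi * (z / 2)))\<^sup>2 + (cos (pi * (z / 2)))\<^sup>2) / (sin (pi * (z / 2)) * cos (pi * (z / 2)))"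
    using s by (simp add: divide_simps power2_eq_square) algebra
  also have "\<dots> = 2 * (pi / (2 * sin (pi * (z / 2)) * cos (pi * (z / 2))))"
    unfolding sin_cos_squared_add by simp
  also have "2 * sin (pi * (z / 2)) * cos (pi * (z / 2)) = sin (pi * z)"
    using sin_double[of "pi * (z / 2)"] by simp
  finally show ?thesis by simp
qed

text \<open>
  For \<open>p > 0\<close> this is \<open>\<integral>t in 0..1. t powr (p - 1) / (1 + t)^(k + 1)\<close>, and the recursion comes from
  integrating the derivative of \<open>t powr p / (1 + t)^k\<close>. Taking the recursion as the definition gives a meaning
  also for \<open>p \<le> 0\<close>, where the integral diverges. Such arguments occur when \<open>p\<close> is lowered \<open>k\<close> times
  to reach the digamma terms of the closed form.
\<close>

fun beta_k :: "nat \<Rightarrow> real \<Rightarrow> real" where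
  "beta_k 0 p = alt_beta p"
| "beta_k (Suc k) p = (1 / 2 ^ Suc k + (real (Suc k) - p) * beta_k k p) / real (Suc k)"

text \<open>
  A second recursion, lowering both parameters. For \<open>p > 1\<close> it is integration by parts. For the
  continued function it is an algebraic consequence of the defining recursion, with
  \<open>alt_beta_plus1\<close> as the base case.
\<close>

lemma beta_k_lower:
  assumes "p \<noteq> 1"
  shows "beta_k (Suc k) p = (- 1 / 2 ^ Suc k + (p - 1) * beta_k k (p - 1)) / real (Suc k)"
proof (induction k)
  case 0
  have "alt_beta p = 1 / (p - 1) - alt_beta (p - 1)" using alt_beta_plus1[of "p - 1"] assms by simp
  hence "(p - 1) * alt_beta p = 1 - (p - 1) * alt_beta (p - 1)" using assms by (simp add: right_diff_distrib)
  thus ?case by (simp add: algebra_simps)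
next
  case (Suc k)
  define B where "B = beta_k k (p - 1)"
  have B: "beta_k (Suc k) (p - 1) = (1 / 2 ^ Suc k + (real (Suc k) - (p - 1)) * B) / real (Suc k)"
    by (simp add: B_def)
  have "real (Suc (Suc k)) * beta_k (Suc (Suc k)) p = 1 / 2 ^ Suc (Suc k) + (real (Suc (Suc k)) - p) * beta_k (Suc k) p"
    by simp
  also have "\<dots> = 1 / 2 ^ Suc (Suc k) + (real (Suc (Suc k)) - p) * ((- 1 / 2 ^ Suc k + (p - 1) * B) / real (Suc k))"
    unfolding Suc.IH B_def ..
  also have "\<dots> = - 1 / 2 ^ Suc (Suc k) + (p - 1) * beta_k (Suc k) (p - 1)"
  proof -
    define h K where "h = (1 / 2 ^ Suc k :: real)" and "K = real (Suc k)"
    have "K > 0" by (simp add: K_def)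
    hence "h / 2 + (K + 1 - p) * ((- h + (p - 1) * B) / K) = - h / 2 + (p - 1) * ((h + (K - (p - 1)) * B) / K)"
      by (simp add: divide_simps) algebra
    thus ?thesis unfolding B by (simp add: h_def K_def add_ac)
  qed
  finally have "real (Suc (Suc k)) * beta_k (Suc (Suc k)) p = - 1 / 2 ^ Suc (Suc k) + (p - 1) * beta_k (Suc k) (p - 1)" .
  thus ?case by (simp only: eq_divide_eq mult.commute of_nat_eq_0_iff nat.distinct if_False not_False_eq_True if_True)
qed

text \<open>
  Unrolling \<open>beta_k_lower\<close> \<open>k\<close> times: the constants picked up on the way form the finite sum, the
  products \<open>(p - 1) \<dots> (p - j)\<close> are the quotients \<open>Gamma p * rGamma (p - j)\<close>, and the remaining
  \<open>alt_beta (p - k)\<close> is the digamma difference.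
\<close>

lemma beta_k_closed_form:
  assumes "p - real k \<notin> \<int>\<^sub>\<le>\<^sub>0"
  shows "Gamma p / fact k * ((\<Sum>j<k. 2 powi (int j - 1) * fact (k - j - 1) * rGamma (p - real j))
     + 2 ^ k / 4 * rGamma (p - real k) * (Digamma ((p - real k) / 2) - Digamma ((p - real k + 1) / 2)))
     = - (2 ^ k / 2) * beta_k k p"
  using assms
proof (induction k arbitrary: p)
  case 0
  hence "Gamma p * rGamma p = 1" by (simp add: rGamma_inverse_Gamma Gamma_eq_zero_iff)
  moreover have "Digamma (p / 2) - Digamma ((p + 1) / 2) = - 2 * alt_beta p" by (simp add: alt_beta_def)
  ultimately show ?case by simp
next
  case (Suc k)
  let ?S = "\<lambda>k p. (\<Sum>j<k. 2 powi (int j - 1) * fact (k - j - 1) * rGamma (p - real j)) :: real"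
  let ?T = "\<lambda>k p. 2 ^ k / 4 * rGamma (p - real k) * (Digamma ((p - real k) / 2) - Digamma ((p - real k + 1) / 2))"
  have p1: "p - 1 - real k \<notin> \<int>\<^sub>\<le>\<^sub>0" using Suc.prems by (simp add: algebra_simps)
  have p2: "p - 1 \<notin> \<int>\<^sub>\<le>\<^sub>0"
  proof
    assume "p - 1 \<in> \<int>\<^sub>\<le>\<^sub>0"
    hence "p - 1 - real k \<in> \<int>\<^sub>\<le>\<^sub>0" by (rule nonpos_Ints_diff_Nats) auto
    with p1 show False by simp
  qed
  hence pn1: "p \<noteq> 1" by auto
  have p3: "p \<notin> \<int>\<^sub>\<le>\<^sub>0"
  proof
    assume "p \<in> \<int>\<^sub>\<le>\<^sub>0"
    hence "p - 1 \<in> \<int>\<^sub>\<le>\<^sub>0" by (rule nonpos_Ints_diff_Nats) auto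
    with p2 show False by simp
  qed
  have G: "Gamma p = (p - 1) * Gamma (p - 1)" using Gamma_plus1[OF p2] by simp
  have GG: "Gamma p * rGamma p = 1" using p3 by (simp add: rGamma_inverse_Gamma Gamma_eq_zero_iff)
  have "?S (Suc k) p = 1 / 2 * fact k * rGamma p + 2 * ?S k (p - 1)"
  proof -
    have pw: "(2::real) powi (int (Suc j) - 1) = 2 * 2 powi (int j - 1)" for j
      by (simp add: power_int_diff)
    have pj: "p - real (Suc j) = p - 1 - real j" for j by simp
    have "?S (Suc k) p = 2 powi (int 0 - 1) * fact (Suc k - 0 - 1) * rGamma (p - real 0) +
       (\<Sum>j<k. 2 powi (int (Suc j) - 1) * fact (Suc k - Suc j - 1) * rGamma (p - real (Suc j)))"
      by (rule sum.lessThan_Suc_shift)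
    also have "(\<Sum>j<k. 2 powi (int (Suc j) - 1) * fact (Suc k - Suc j - 1) * rGamma (p - real (Suc j))) = 2 * ?S k (p - 1)"
      unfolding sum_distrib_left pw pj by (intro sum.cong) (auto simp: mult_ac)
    finally show ?thesis by simp
  qed
  moreover have "?T (Suc k) p = 2 * ?T k (p - 1)" by (simp add: algebra_simps)
  moreover have "g / (K * f) * ((1 / 2 * f * r + 2 * S) + 2 * T) = g * r / (2 * K) + 2 * g / (K * f) * (S + T)"
    if "K > 0" "f > 0" for g K f r S T :: real
    using that by (simp add: divide_simps) algebra
  from this[of "real (Suc k)" "fact k" "Gamma p" "rGamma p" "?S k (p - 1)" "?T k (p - 1)"]
  have "Gamma p / fact (Suc k) * ((1 / 2 * fact k * rGamma p + 2 * ?S k (p - 1)) + 2 * ?T k (p - 1)) =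
      Gamma p * rGamma p / (2 * real (Suc k)) + 2 * Gamma p / fact (Suc k) * (?S k (p - 1) + ?T k (p - 1))"
    by (simp only: fact_Suc of_nat_0_less_iff zero_less_Suc fact_gt_zero)
  ultimately have "Gamma p / fact (Suc k) * (?S (Suc k) p + ?T (Suc k) p) =
      Gamma p * rGamma p / (2 * real (Suc k)) + 2 * Gamma p / fact (Suc k) * (?S k (p - 1) + ?T k (p - 1))"
    by (simp only:)
  also have "2 * Gamma p / fact (Suc k) * (?S k (p - 1) + ?T k (p - 1)) =
      2 * (p - 1) / real (Suc k) * (Gamma (p - 1) / fact k * (?S k (p - 1) + ?T k (p - 1)))"
    unfolding G by simp
  also have "\<dots> = 2 * (p - 1) / real (Suc k) * (- (2 ^ k / 2) * beta_k k (p - 1))"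
    unfolding Suc.IH[OF p1] ..
  also have "Gamma p * rGamma p / (2 * real (Suc k)) + \<dots> = - (2 ^ Suc k / 2) * beta_k (Suc k) p"
  proof -
    have "1 / (2 * K) + 2 * (p - 1) / K * (- (h / 2) * B) = - (2 * h / 2) * ((- 1 / (2 * h) + (p - 1) * B) / K)"
      if "K > 0" "h > 0" for K h B :: real
      using that by (simp add: divide_simps)
    from this[of "real (Suc k)" "2 ^ k" "beta_k k (p - 1)"]
    show ?thesis unfolding beta_k_lower[OF pn1] GG by (simp del: of_nat_Suc)
  qed
  finally show ?case .
qed

lemma borel_measurable_beta_k [measurable]: "beta_k k \<in> borel_measurable borel"
proof (induction k)
  case 0
  show ?case unfolding beta_k.simps[abs_def] alt_beta_def Digamma_def by measurable
qed simp

section \<open>Exponential moments of powers of the hyperbolic secant\<close>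

lemma sech_pos [simp]: "sech x > 0"
  by (simp add: sech_def)

lemma sech_nonneg [simp]: "sech x \<ge> 0"
  by (simp add: less_imp_le)

lemma sech_exp: "sech x = 2 * exp (-x) / (1 + exp (-2*x))"
proof -
  have 1: "exp (-2*x) = exp (-x) * exp (-x)" by (subst exp_add[symmetric]) simp
  have "cosh x = (1 + exp (-x) * exp (-x)) / (2 * exp (-x))"
    unfolding cosh_def by (simp add: field_simps flip: exp_add)
  thus ?thesis unfolding sech_def 1 by simp
qed

lemma sech_le: "sech x \<le> 2 * exp (-x)"
  unfolding sech_exp by (simp add: field_simps add_pos_pos)

lemma sech_le_1: "sech x \<le> 1"
  using cosh_real_ge_1[of x] by (simp add: sech_def)

lemma sech_power_le:
  assumes "m \<ge> 1"
  shows "sech x ^ m \<le> sech x"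
  using power_decreasing[of 1 m "sech x"] assms sech_le_1[of x] by (simp add: less_imp_le)

lemma one_minus_tanh_square: "1 - (tanh x)\<^sup>2 = (sech x)\<^sup>2" for x :: real
proof -
  have c: "cosh x \<noteq> 0" using cosh_real_pos[of x] by linarith
  have "(cosh x)\<^sup>2 - (sinh x)\<^sup>2 = 1" by (simp add: cosh_square_eq)
  moreover have "1 - (tanh x)\<^sup>2 = ((cosh x)\<^sup>2 - (sinh x)\<^sup>2) / (cosh x)\<^sup>2"
    using c by (simp add: tanh_def power_divide diff_divide_distrib del: cosh_square_eq)
  ultimately show ?thesis by (simp only: sech_def power_divide power_one)
qed

lemma DERIV_sech [derivative_intros]:
  "(f has_real_derivative f') (at x within A) \<Longrightarrow>
   ((\<lambda>x. sech (f x)) has_real_derivative - tanh (f x) * sech (f x) * f') (at x within A)"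
  unfolding sech_def tanh_def
  by (auto intro!: derivative_eq_intros simp: field_simps power2_eq_square)

lemma DERIV_sech_power:
  "((\<lambda>x. sech x ^ m) has_real_derivative - real m * tanh x * sech x ^ m) (at x)"
proof (induction m)
  case (Suc m)
  have "((\<lambda>x. sech x) has_real_derivative - tanh x * sech x) (at x)"
    by (auto intro!: derivative_eq_intros)
  from DERIV_mult[OF this Suc.IH] show ?case by (simp add: algebra_simps)
qed simp

lemma isCont_sech [continuous_intros]: "isCont f x \<Longrightarrow> isCont (\<lambda>x. sech (f x)) x" for f :: "real \<Rightarrow> real"
  unfolding sech_def by (intro continuous_intros) auto

lemma measurable_sech [measurable]: "sech \<in> borel_measurable borel"
  unfolding sech_def cosh_def by measurable

text \<open>
  The integral of a single term of the series for the weighted hyperbolic secant below.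
\<close>

lemma has_bochner_integral_exp_diff:
  fixes c d :: real
  assumes c: "0 < c" "c \<le> d"
  shows "has_bochner_integral lborel
    (\<lambda>x. indicator {0<..} x * (2 * exp (-c * x) - 2 * exp (-d * x))) (2 / c - 2 / d)"
proof -
  let ?F = "\<lambda>x. 2 / d * exp (-d * x) - 2 / c * exp (-c * x)"
  have "has_bochner_integral lborel
    (\<lambda>x. indicator {0<..} x * (2 * exp (-c * x) - 2 * exp (-d * x))) (0 - (2 / d - 2 / c))"
  proof (rule has_bochner_integral_FTC_Ioi_nonneg[where F = ?F])
    fix x :: real assume x: "x > 0"
    show "(?F has_real_derivative (2 * exp (-c * x) - 2 * exp (-d * x))) (at x)"
      using c by (auto intro!: derivative_eq_intros)
    show "isCont (\<lambda>x. 2 * exp (-c * x) - 2 * exp (-d * x)) x" by (intro continuous_intros)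
    show "2 * exp (-c * x) - 2 * exp (-d * x) \<ge> 0" using x c by simp
  next
    have "(?F \<longlongrightarrow> ?F 0) (at_right 0)" by (intro tendsto_at_right_cont continuous_intros)
    thus "(?F \<longlongrightarrow> 2 / d - 2 / c) (at_right 0)" by simp
    have E: "((\<lambda>x. exp (- c * x)) \<longlongrightarrow> 0) at_top" if "c > 0" for c :: real
      using that by real_asymp
    have "(?F \<longlongrightarrow> 2 / d * 0 - 2 / c * 0) at_top" using c by (intro tendsto_intros E) auto
    thus "(?F \<longlongrightarrow> 0) at_top" by simp
  qed
  thus ?thesis by simp
qed

text \<open>
  Expanding \<open>sech\<close> into exponentials and integrating term by term reproduces \<open>alt_beta_sums\<close>.
\<close>

lemma has_bochner_integral_sech_beta:
  assumes s: "s > 0"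
  shows "has_bochner_integral lborel (\<lambda>x. indicator {0<..} x * (exp (-(s-1)*x) * sech x)) (alt_beta (s / 2))"
proof -
  define t where "t = (\<lambda>n x. 2 * exp (-(s + 4 * real n) * x) - 2 * exp (-(s + 4 * real n + 2) * x))"
  have p: "s + 4 * real n > 0" "s + 4 * real n + 2 > 0" for n using s by (auto intro: add_pos_nonneg)
  have t_nonneg: "t n x \<ge> 0" if "x > 0" for n x
    using that s by (simp add: t_def)
  have bt: "has_bochner_integral lborel (\<lambda>x. indicator {0<..} x * t n x) (2 / (s + 4 * real n) - 2 / (s + 4 * real n + 2))" for n
    unfolding t_def using p[of n] by (intro has_bochner_integral_exp_diff) auto
  define c where "c = (\<lambda>n. 2 / (s + 4 * real n) - 2 / (s + 4 * real n + 2))"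
  have nnt: "(\<integral>\<^sup>+x. ennreal (indicator {0<..} x * t n x) \<partial>lborel) = ennreal (c n)" for n
    using bt[of n] t_nonneg by (subst nn_integral_eq_integral)
      (auto simp: has_bochner_integral_iff c_def indicator_def intro!: AE_I2)
  have c_sums: "c sums alt_beta (s / 2)"
  proof -
    have "c n = 1 / (2 * real n + s / 2) - 1 / (2 * real n + s / 2 + 1)" for n
    proof -
      have "2 * real n + s / 2 = (s + 4 * real n) / 2" "2 * real n + s / 2 + 1 = (s + 4 * real n + 2) / 2"
        by (simp_all add: field_simps)
      thus ?thesis unfolding c_def by (simp only: divide_divide_eq_right mult_1)
    qed
    hence "c = (\<lambda>n. 1 / (2 * real n + s / 2) - 1 / (2 * real n + s / 2 + 1))" by (rule ext)
    thus ?thesis using alt_beta_sums[of "s / 2"] s by (simp only:)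
  qed
  have c_nonneg: "c n \<ge> 0" for n using p[of n] by (simp add: c_def frac_le)
  have t_sums: "(\<lambda>n. t n x) sums (exp (-(s-1)*x) * sech x)" if x: "x > 0" for x
  proof -
    \<comment> \<open>Multiplying numerator and denominator of \<open>2 exp (-s x) / (1 + exp (-2 x))\<close> by
      \<open>1 - exp (-2 x)\<close> turns an alternating geometric series into one with nonnegative terms,
      to which monotone convergence applies.\<close>
    have "(\<lambda>n. (2 * exp (-s*x) * (1 - exp (-2*x))) * exp (-4*x) ^ n) sums
       ((2 * exp (-s*x) * (1 - exp (-2*x))) * (1 / (1 - exp (-4*x))))"
      using x by (intro sums_mult geometric_sums) auto
    also have "(\<lambda>n. (2 * exp (-s*x) * (1 - exp (-2*x))) * exp (-4*x) ^ n) = (\<lambda>n. t n x)"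
    proof
      fix n
      have "exp (-4*x) ^ n = exp (- (4 * real n) * x)"
        by (subst exp_of_nat_mult[symmetric]) (simp add: mult_ac)
      moreover have "exp (-(s + 4 * real n) * x) = exp (-s*x) * exp (- (4 * real n) * x)"
        by (subst exp_add[symmetric]) (simp add: algebra_simps)
      moreover have "exp (-(s + 4 * real n + 2) * x) = exp (-s*x) * exp (- (4 * real n) * x) * exp (-2 * x)"
        by (subst exp_add[symmetric])+ (simp add: algebra_simps)
      ultimately show "(2 * exp (-s*x) * (1 - exp (-2*x))) * exp (-4*x) ^ n = t n x"
        unfolding t_def by (simp only: algebra_simps)
    qed
    also have "exp (-4*x) = exp (-2*x) * exp (-2*x)" by (subst exp_add[symmetric]) simp
    also have "1 - exp (-2*x) * exp (-2*x) = (1 - exp (-2*x)) * (1 + exp (-2*x))" by (simp only: algebra_simps)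
    also have "(2 * exp (-s*x) * (1 - exp (-2*x))) * (1 / ((1 - exp (-2*x)) * (1 + exp (-2*x)))) =
       2 * exp (-s*x) / (1 + exp (-2*x))" using x by simp
    also have "exp (-s*x) = exp (-(s-1)*x) * exp (-x)"
      by (subst exp_add[symmetric]) (simp add: algebra_simps)
    also have "2 * (exp (-(s-1)*x) * exp (-x)) / (1 + exp (-2*x)) = exp (-(s-1)*x) * sech x"
      unfolding sech_exp by simp
    finally show ?thesis .
  qed
  have "(\<integral>\<^sup>+x. ennreal (indicator {0<..} x * (exp (-(s-1)*x) * sech x)) \<partial>lborel) =
     (\<integral>\<^sup>+x. (\<Sum>n. ennreal (indicator {0<..} x * t n x)) \<partial>lborel)"
  proof (rule nn_integral_cong)
    fix x :: real
    show "ennreal (indicator {0<..} x * (exp (-(s-1)*x) * sech x)) = (\<Sum>n. ennreal (indicator {0<..} x * t n x))"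
    proof (cases "x > 0")
      case True
      have "(\<Sum>n. ennreal (t n x)) = ennreal (exp (-(s-1)*x) * sech x)"
        using t_sums[OF True] t_nonneg[OF True] by (intro suminf_ennreal_eq)
      thus ?thesis using True by simp
    qed auto
  qed
  also have "\<dots> = (\<Sum>n. ennreal (c n))"
    unfolding nnt[symmetric] by (rule nn_integral_suminf) (unfold t_def, measurable)
  also have "\<dots> = ennreal (alt_beta (s / 2))"
    using c_sums c_nonneg by (intro suminf_ennreal_eq)
  finally have "(\<integral>\<^sup>+x. ennreal (indicator {0<..} x * (exp (-(s-1)*x) * sech x)) \<partial>lborel) = ennreal (alt_beta (s / 2))" .
  moreover have "alt_beta (s / 2) \<ge> 0" using sums_le[OF c_nonneg sums_zero c_sums] .
  ultimately show ?thesis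
    by (intro has_bochner_integral_nn_integral) auto
qed

text \<open>
  The total derivative of \<open>exp (- s x) sech x ^ k\<close> relates the moment of order \<open>k + 1\<close> at \<open>s\<close> to the one of
  order \<open>k\<close> at \<open>s + 1\<close>; up to powers of 2 this is the recursion defining \<^const>\<open>beta_k\<close>.
\<close>

lemma has_bochner_integral_sech_power:
  assumes "s > 0"
  shows "has_bochner_integral lborel (\<lambda>x. indicator {0<..} x * (exp (-(s-1)*x) * sech x ^ Suc k))
     (2 ^ k * beta_k k ((s + real k) / 2))"
  using assms
proof (induction k arbitrary: s)
  case 0
  thus ?case using has_bochner_integral_sech_beta[of s] by simp
next
  case (Suc k)
  define K where "K = Suc k"
  define f where "f = (\<lambda>x. exp (- s * x) * sech x ^ K)"
  define g where "g = (\<lambda>x. exp (-(s-1)*x) * sech x ^ Suc K)"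
  have f: "has_bochner_integral lborel (\<lambda>x. indicator {0<..} x * f x) (2 ^ k * beta_k k ((s + real K) / 2))"
    using Suc.IH[of "s + 1"] Suc.prems by (simp add: f_def K_def add_ac)
  have g: "integrable lborel (\<lambda>x. indicator {0<..} x * g x)"
  proof (rule Bochner_Integration.integrable_bound)
    show "integrable lborel (\<lambda>x. indicator {0<..} x * (exp (-(s-1)*x) * sech x))"
      using has_bochner_integral_sech_beta[of s] Suc.prems by (auto simp: has_bochner_integral_iff)
    show "AE x in lborel. norm (indicator {0<..} x * g x) \<le> norm (indicator {0<..} x * (exp (-(s-1)*x) * sech x))"
    proof (rule AE_I2)
      fix x
      have "sech x ^ Suc K \<le> sech x" using power_decreasing[of 1 "Suc K" "sech x"] sech_le_1[of x] by (simp add: less_imp_le)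
      thus "norm (indicator {0<..} x * g x) \<le> norm (indicator {0<..} x * (exp (-(s-1)*x) * sech x))"
        by (auto simp: g_def indicator_def abs_mult less_imp_le)
    qed
  qed (unfold g_def, measurable)
  have F: "((\<lambda>x. exp (- s * x) * sech x ^ K) has_real_derivative (real K - s) * f x - real K * g x) (at x)" for x
  proof -
    \<comment> \<open>Writing \<open>tanh\<close> as \<open>exp x sech x - 1\<close> rather than \<open>1 - exp (-x) sech x\<close> leads to the
      moment at \<open>s + 1\<close> instead of the one at \<open>s - 1\<close>, so all parameters stay positive.\<close>
    have t: "tanh x * exp (- s * x) = - exp (- s * x) + exp (-(s-1)*x) * sech x"
    proof -
      have "tanh x = exp x * sech x - 1"
        using cosh_real_pos[of x] by (simp add: tanh_def sech_def field_simps cosh_plus_sinh[symmetric])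
      moreover have "exp (-(s-1)*x) = exp (- s * x) * exp x" by (subst exp_add[symmetric]) (simp add: algebra_simps)
      moreover have "(u * v - 1) * w = - w + w * u * v" for u v w :: real by algebra
      ultimately show ?thesis by (simp only:)
    qed
    have "(real K - s) * f x - real K * g x = - s * exp (- s * x) * sech x ^ K
      - real K * (- exp (- s * x) + exp (-(s-1)*x) * sech x) * sech x ^ K"
      by (simp add: f_def g_def algebra_simps)
    also have "\<dots> = - s * exp (- s * x) * sech x ^ K - real K * tanh x * exp (- s * x) * sech x ^ K"
      unfolding t[symmetric] by simp
    finally have eq: "(real K - s) * f x - real K * g x = \<dots>" .
    have "((\<lambda>x. exp (- s * x)) has_real_derivative - s * exp (- s * x)) (at x)"
      by (auto intro!: derivative_eq_intros)
    from DERIV_mult[OF this DERIV_sech_power[of K x]] show ?thesis unfolding eq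
      by (simp add: algebra_simps)
  qed
  have "(\<integral>x. indicator {0<..} x * ((real K - s) * f x - real K * g x) \<partial>lborel) = 0 - 1"
  proof (rule integral_FTC_Ioi[OF F])
    show "isCont (\<lambda>x. (real K - s) * f x - real K * g x) x" for x
      unfolding f_def g_def by (intro continuous_intros)
    have "integrable lborel (\<lambda>x. (real K - s) * (indicator {0<..} x * f x) - real K * (indicator {0<..} x * g x))"
      using f g by (intro Bochner_Integration.integrable_diff integrable_mult_right) (auto simp: has_bochner_integral_iff)
    thus "integrable lborel (\<lambda>x. indicator {0<..} x * ((real K - s) * f x - real K * g x))"
      by (simp add: algebra_simps)
    have "((\<lambda>x. exp (- s * x) * sech x ^ K) \<longlongrightarrow> exp (- s * 0) * sech 0 ^ K) (at_right 0)"
      by (intro tendsto_at_right_cont continuous_intros)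
    thus "((\<lambda>x. exp (- s * x) * sech x ^ K) \<longlongrightarrow> 1) (at_right 0)" by (simp add: sech_def)
    have "((\<lambda>x. exp (- s * x)) \<longlongrightarrow> 0) at_top" using Suc.prems by real_asymp
    thus "((\<lambda>x. exp (- s * x) * sech x ^ K) \<longlongrightarrow> 0) at_top"
    proof (rule Lim_null_comparison[rotated], intro always_eventually allI)
      fix x
      have "sech x ^ K \<le> 1" by (intro power_le_one) (auto simp: sech_le_1 less_imp_le)
      thus "norm (exp (- s * x) * sech x ^ K) \<le> exp (- s * x)" by (simp add: abs_mult abs_of_pos)
    qed
  qed
  also have "(\<lambda>x. indicator {0<..} x * ((real K - s) * f x - real K * g x)) =
     (\<lambda>x. (real K - s) * (indicator {0<..} x * f x) - real K * (indicator {0<..} x * g x))"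
    by (simp add: algebra_simps)
  also have "(\<integral>x. ((real K - s) * (indicator {0<..} x * f x) - real K * (indicator {0<..} x * g x)) \<partial>lborel) =
     (real K - s) * (2 ^ k * beta_k k ((s + real K) / 2)) - real K * (\<integral>x. indicator {0<..} x * g x \<partial>lborel)"
    using f g by (subst Bochner_Integration.integral_diff) (auto simp: has_bochner_integral_iff)
  finally have "real K * (\<integral>x. indicator {0<..} x * g x \<partial>lborel) = 1 + (real K - s) * (2 ^ k * beta_k k ((s + real K) / 2))"
    by simp
  also have "\<dots> = real K * (2 ^ K * beta_k K ((s + real K) / 2))"
  proof -
    have "1 + (c - s) * (h * B) = c * (2 * h * ((1 / (2 * h) + (c - (s + c) / 2) * B) / c))"
      if "c > 0" "h > 0" for c h B :: real
      using that by (simp add: field_simps)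
    from this[of "real K" "2 ^ k" "beta_k k ((s + real K) / 2)"] show ?thesis
      by (simp add: K_def del: of_nat_Suc)
  qed
  finally have "(\<integral>x. indicator {0<..} x * g x \<partial>lborel) = 2 ^ K * beta_k K ((s + real K) / 2)"
    by (simp only: mult_cancel_left K_def of_nat_eq_0_iff nat.distinct simp_thms)
  with g show ?case by (simp add: has_bochner_integral_iff g_def K_def)
qed

text \<open>
  A bound uniform in \<open>s\<close>, from \<open>exp x * sech x \<le> 2\<close>. A second factor \<open>sech\<close> keeps the
  remaining integral finite; the moment of \<open>sech\<close> itself is unbounded near \<open>s = 0\<close>.
\<close>

lemma beta_k_bounds:
  assumes s: "0 < s" "s < 2"
  shows "0 \<le> beta_k (Suc k) ((s + real (Suc k)) / 2)"
    and "2 ^ Suc k * beta_k (Suc k) ((s + real (Suc k)) / 2) \<le> 2 * alt_beta (1 / 2)"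
proof -
  note I = has_bochner_integral_sech_power[OF s(1), of "Suc k"]
  have "0 \<le> (\<integral>x. indicator {0<..} x * (exp (-(s-1)*x) * sech x ^ Suc (Suc k)) \<partial>lborel)"
    by (rule Bochner_Integration.integral_nonneg) (simp add: less_imp_le)
  thus "0 \<le> beta_k (Suc k) ((s + real (Suc k)) / 2)"
    using mult_le_cancel_left_pos[of "2 ^ Suc k" 0 "beta_k (Suc k) ((s + real (Suc k)) / 2)"]
    unfolding has_bochner_integral_integral_eq[OF I] by (simp del: beta_k.simps of_nat_Suc)
  have I2: "has_bochner_integral lborel (\<lambda>x. 2 * (indicator {0<..} x * (exp (-(1-1)*x) * sech x))) (2 * alt_beta (1 / 2))"
    using has_bochner_integral_sech_beta[of 1] by (intro has_bochner_integral_mult_right) auto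
  have "(\<integral>x. indicator {0<..} x * (exp (-(s-1)*x) * sech x ^ Suc (Suc k)) \<partial>lborel) \<le>
     (\<integral>x. 2 * (indicator {0<..} x * (exp (-(1-1)*x) * sech x)) \<partial>lborel)"
  proof (rule integral_mono)
    fix x :: real
    show "indicator {0<..} x * (exp (-(s-1)*x) * sech x ^ Suc (Suc k)) \<le> 2 * (indicator {0<..} x * (exp (-(1-1)*x) * sech x))"
    proof (cases "x > 0")
      case True
      have "exp (-(s-1)*x) \<le> exp x" using True s by simp
      moreover have "sech x ^ Suc (Suc k) \<le> sech x ^ 2"
        using sech_le_1[of x] by (intro power_decreasing) (auto simp: less_imp_le)
      ultimately have "exp (-(s-1)*x) * sech x ^ Suc (Suc k) \<le> exp x * sech x ^ 2"
        by (intro mult_mono) (auto simp: less_imp_le)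
      also have "\<dots> = (exp x * sech x) * sech x" by (simp add: power2_eq_square)
      also have "\<dots> \<le> (exp x * (2 * exp (-x))) * sech x"
        using sech_le[of x] by (intro mult_mono) (auto simp: less_imp_le)
      also have "\<dots> = 2 * sech x" by (simp add: exp_minus)
      finally show ?thesis using True by simp
    qed auto
  qed (use I I2 in \<open>simp_all only: has_bochner_integral_iff\<close>)
  thus "2 ^ Suc k * beta_k (Suc k) ((s + real (Suc k)) / 2) \<le> 2 * alt_beta (1 / 2)"
    unfolding has_bochner_integral_integral_eq[OF I] has_bochner_integral_integral_eq[OF I2] .
qed

section \<open>Averages of exponentials over the unit square\<close>

text \<open>
  This is \<open>(sech x ^ k - sech x ^ (k + 1)) / x\<^sup>2\<close>. Its sum over \<open>k < m\<close> telescopes, while the factor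
  \<open>(cosh x - 1) / x\<^sup>2\<close> is an average of exponentials.
\<close>

definition sech_sq_kernel :: "nat \<Rightarrow> real \<Rightarrow> real" where
  "sech_sq_kernel k x = sech x ^ Suc k * (cosh x - 1) / x\<^sup>2"

lemma sech_sq_kernel_nonneg: "sech_sq_kernel k x \<ge> 0"
  using cosh_real_ge_1[of x] by (simp add: sech_sq_kernel_def less_imp_le)

lemma borel_measurable_sech_sq_kernel [measurable]: "sech_sq_kernel k \<in> borel_measurable borel"
  unfolding sech_sq_kernel_def cosh_def by measurable

lemma sum_sech_sq_kernel: "(\<Sum>k<m. sech_sq_kernel k x) = (1 - sech x ^ m) / x\<^sup>2"
proof (induction m)
  case (Suc m)
  have "sech x * cosh x = 1" by (simp add: sech_def)
  hence "sech_sq_kernel m x = (sech x ^ m - sech x ^ Suc m) / x\<^sup>2"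
    by (simp add: sech_sq_kernel_def algebra_simps)
  with Suc show ?case by (simp add: diff_divide_distrib)
qed simp

lemma nn_integral_exp_unit:
  fixes c x :: real
  assumes x: "x > 0"
  shows "(\<integral>\<^sup>+a. ennreal (indicator {0<..<1} a * exp (-(a + c) * x)) \<partial>lborel) =
         ennreal (exp (-c * x) * (1 - exp (-x)) / x)"
proof -
  let ?F = "\<lambda>a. - exp (-(a + c) * x) / x"
  have "has_bochner_integral lborel (\<lambda>a. indicator {0<..<1} a * exp (-(a + c) * x)) (?F 1 - ?F 0)"
  proof (rule has_bochner_integral_FTC_01_nonneg)
    show "(?F has_real_derivative exp (-(a + c) * x)) (at a)" for a
      using x by (auto intro!: derivative_eq_intros)
    show "isCont (\<lambda>a. exp (-(a + c) * x)) a" for a by (intro continuous_intros)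
    show "(?F \<longlongrightarrow> ?F 0) (at_right 0)" "(?F \<longlongrightarrow> ?F 1) (at_left 1)"
      by (rule tendsto_at_right_cont tendsto_at_left_cont, use x in \<open>intro continuous_intros; simp\<close>)+
  qed auto
  moreover have "?F 1 - ?F 0 = exp (-c * x) * (1 - exp (-x)) / x"
  proof -
    have "exp (-(1 + c) * x) = exp (-c * x) * exp (-x)" by (subst exp_add[symmetric]) (simp add: algebra_simps)
    thus ?thesis using x by (simp only: ) (simp add: field_simps)
  qed
  ultimately show ?thesis
    by (subst nn_integral_eq_integral) (auto simp: has_bochner_integral_iff)
qed

text \<open>
  The double integral is the square of \<open>(1 - exp (-x)) / x\<close> times \<open>exp x\<close>, i.e. the square of
  \<open>2 sinh (x / 2) / x\<close>. This is the origin of the parameters \<open>a\<close> and \<open>b\<close> in the final formula.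
\<close>

lemma nn_integral_exp_unit_square:
  fixes x :: real
  assumes x: "x > 0"
  shows "(\<integral>\<^sup>+b. (\<integral>\<^sup>+a. ennreal (indicator {0<..<1} b * indicator {0<..<1} a * exp (-(a + b - 1) * x)) \<partial>lborel) \<partial>lborel) =
         ennreal (2 * (cosh x - 1) / x\<^sup>2)"
proof -
  define C where "C = exp x * (1 - exp (-x)) / x"
  have C: "C \<ge> 0" using x by (simp add: C_def)
  have "(\<integral>\<^sup>+a. ennreal (indicator {0<..<1} b * indicator {0<..<1} a * exp (-(a + b - 1) * x)) \<partial>lborel) =
        ennreal C * ennreal (indicator {0<..<1} b * exp (-(b + 0) * x))" for b
  proof (cases "b \<in> {0<..<1}")
    case True
    have "(\<integral>\<^sup>+a. ennreal (indicator {0<..<1} a * exp (-(a + (b - 1)) * x)) \<partial>lborel) =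
      ennreal (exp (-(b - 1) * x) * (1 - exp (-x)) / x)"
      by (rule nn_integral_exp_unit[OF x])
    also have "exp (-(b - 1) * x) = exp x * exp (-(b + 0) * x)"
      by (subst exp_add[symmetric]) (simp add: algebra_simps)
    also have "exp x * exp (-(b + 0) * x) * (1 - exp (-x)) / x = C * exp (-(b + 0) * x)"
      by (simp add: C_def)
    finally show ?thesis using True C by (simp add: ennreal_mult' algebra_simps)
  qed auto
  hence "(\<integral>\<^sup>+b. (\<integral>\<^sup>+a. ennreal (indicator {0<..<1} b * indicator {0<..<1} a * exp (-(a + b - 1) * x)) \<partial>lborel) \<partial>lborel) =
    (\<integral>\<^sup>+b. ennreal C * ennreal (indicator {0<..<1} b * exp (-(b + 0) * x)) \<partial>lborel)" by simp
  also have "\<dots> = ennreal C * (\<integral>\<^sup>+b. ennreal (indicator {0<..<1} b * exp (-(b + 0) * x)) \<partial>lborel)"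
    by (rule nn_integral_cmult) measurable
  also have "\<dots> = ennreal (C * (exp (-0 * x) * (1 - exp (-x)) / x))"
    using C by (simp only: nn_integral_exp_unit[OF x] ennreal_mult')
  also have "C * (exp (-0 * x) * (1 - exp (-x)) / x) = 2 * (cosh x - 1) / x\<^sup>2"
  proof -
    have "exp x * exp (-x) = 1" by (simp flip: exp_add)
    hence "exp x * (1 - exp (-x)) * (1 - exp (-x)) = exp x + exp (-x) - 2" by algebra
    also have "\<dots> = 2 * (cosh x - 1)" by (simp add: cosh_def)
    finally show ?thesis using x by (simp add: C_def power2_eq_square)
  qed
  finally show ?thesis .
qed

text \<open>
  Tonelli's theorem, with the kernel written as an average of exponentials over the unit square;
  the innermost integral is then a moment of a power of \<open>sech\<close> at \<open>s = a + b\<close>.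
\<close>

lemma nn_integral_sech_sq_kernel:
  "(\<integral>\<^sup>+x. ennreal (indicator {0<..} x * (2 * sech_sq_kernel k x)) \<partial>lborel) =
   (\<integral>\<^sup>+b. (\<integral>\<^sup>+a. ennreal (indicator {0<..<1} b * indicator {0<..<1} a *
       (2 ^ k * beta_k k ((a + b + real k) / 2))) \<partial>lborel) \<partial>lborel)"
proof -
  define f :: "real \<Rightarrow> real \<Rightarrow> real \<Rightarrow> real" where
    "f = (\<lambda>x b a. indicator {0<..} x * sech x ^ Suc k * (indicator {0<..<1} b * indicator {0<..<1} a * exp (-(a + b - 1) * x)))"
  have fm: "(\<lambda>(x, b, a). ennreal (f x b a)) \<in> borel_measurable (lborel \<Otimes>\<^sub>M lborel \<Otimes>\<^sub>M lborel)"
    unfolding f_def by measurable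
  have "(\<integral>\<^sup>+x. ennreal (indicator {0<..} x * (2 * sech_sq_kernel k x)) \<partial>lborel) =
      (\<integral>\<^sup>+x. (\<integral>\<^sup>+b. (\<integral>\<^sup>+a. ennreal (f x b a) \<partial>lborel) \<partial>lborel) \<partial>lborel)"
  proof (rule nn_integral_cong)
    fix x :: real
    show "ennreal (indicator {0<..} x * (2 * sech_sq_kernel k x)) = (\<integral>\<^sup>+b. (\<integral>\<^sup>+a. ennreal (f x b a) \<partial>lborel) \<partial>lborel)"
    proof (cases "x > 0")
      case True
      define S where "S = sech x ^ Suc k"
      have S: "S \<ge> 0" by (simp add: S_def less_imp_le)
      let ?g = "\<lambda>b a. indicator {0<..<1} b * indicator {0<..<1} a * exp (-(a + b - 1) * x)"
      have "(\<integral>\<^sup>+b. (\<integral>\<^sup>+a. ennreal (f x b a) \<partial>lborel) \<partial>lborel) =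
         (\<integral>\<^sup>+b. (\<integral>\<^sup>+a. ennreal S * ennreal (?g b a) \<partial>lborel) \<partial>lborel)"
      proof -
        have "ennreal (f x b a) = ennreal S * ennreal (?g b a)" for a b
        proof -
          have "f x b a = S * ?g b a" using True by (simp add: f_def S_def)
          thus ?thesis by (simp only: ennreal_mult'[OF S])
        qed
        thus ?thesis by (simp only:)
      qed
      also have "\<dots> = (\<integral>\<^sup>+b. ennreal S * (\<integral>\<^sup>+a. ennreal (?g b a) \<partial>lborel) \<partial>lborel)"
        by (subst nn_integral_cmult) auto
      also have "\<dots> = ennreal S * (\<integral>\<^sup>+b. (\<integral>\<^sup>+a. ennreal (?g b a) \<partial>lborel) \<partial>lborel)"
        by (rule nn_integral_cmult) measurable
      also have "\<dots> = ennreal S * ennreal (2 * (cosh x - 1) / x\<^sup>2)"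
        unfolding nn_integral_exp_unit_square[OF True] ..
      also have "\<dots> = ennreal (indicator {0<..} x * (2 * sech_sq_kernel k x))"
      proof -
        have "indicator {0<..} x * (2 * sech_sq_kernel k x) = S * (2 * (cosh x - 1) / x\<^sup>2)"
          using True by (simp add: sech_sq_kernel_def S_def)
        thus ?thesis by (simp only: ennreal_mult'[OF S])
      qed
      finally show ?thesis ..
    qed (simp add: f_def)
  qed
  also have "\<dots> = (\<integral>\<^sup>+b. (\<integral>\<^sup>+x. (\<integral>\<^sup>+a. ennreal (f x b a) \<partial>lborel) \<partial>lborel) \<partial>lborel)"
    by (rule lborel_pair.Fubini') (unfold f_def, measurable)
  also have "\<dots> = (\<integral>\<^sup>+b. (\<integral>\<^sup>+a. (\<integral>\<^sup>+x. ennreal (f x b a) \<partial>lborel) \<partial>lborel) \<partial>lborel)"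
    by (intro nn_integral_cong lborel_pair.Fubini') (unfold f_def, measurable)
  also have "\<dots> = (\<integral>\<^sup>+b. (\<integral>\<^sup>+a. ennreal (indicator {0<..<1} b * indicator {0<..<1} a *
       (2 ^ k * beta_k k ((a + b + real k) / 2))) \<partial>lborel) \<partial>lborel)"
  proof (intro nn_integral_cong)
    fix a b :: real
    show "(\<integral>\<^sup>+x. ennreal (f x b a) \<partial>lborel) = ennreal (indicator {0<..<1} b * indicator {0<..<1} a *
       (2 ^ k * beta_k k ((a + b + real k) / 2)))"
    proof (cases "a \<in> {0<..<1} \<and> b \<in> {0<..<1}")
      case True
      hence "has_bochner_integral lborel (\<lambda>x. indicator {0<..} x * (exp (-(a + b-1)*x) * sech x ^ Suc k))
         (2 ^ k * beta_k k ((a + b + real k) / 2))"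
        by (intro has_bochner_integral_sech_power) auto
      moreover have "f x b a = indicator {0<..} x * (exp (-(a + b-1)*x) * sech x ^ Suc k)" for x
        using True by (simp add: f_def mult_ac)
      ultimately have "has_bochner_integral lborel (\<lambda>x. f x b a) (2 ^ k * beta_k k ((a + b + real k) / 2))"
        by simp
      moreover have "f x b a \<ge> 0" for x by (simp add: f_def less_imp_le)
      ultimately have "(\<integral>\<^sup>+x. ennreal (f x b a) \<partial>lborel) = ennreal (2 ^ k * beta_k k ((a + b + real k) / 2))"
        by (subst nn_integral_eq_integral) (auto simp: has_bochner_integral_iff)
      thus ?thesis using True by simp
    qed (auto simp: f_def)
  qed
  finally show ?thesis .
qed

lemma has_bochner_integral_sech_sq_kernel:
  assumes k: "k \<ge> 1"
  shows "has_bochner_integral lborel (\<lambda>x. indicator {0<..} x * sech_sq_kernel k x)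
     (1 / 2 * (LBINT b=0..1. (LBINT a=0..1. 2 ^ k * beta_k k ((a + b + real k) / 2))))"
proof -
  define g where "g = (\<lambda>b a. indicator {0<..<1} b * indicator {0<..<1} a * (2 ^ k * beta_k k ((a + b + real k) / 2)) :: real)"
  define M where "M = 2 * alt_beta (1 / 2)"
  have g: "0 \<le> g b a" "g b a \<le> M * indicator {0<..<1} b * indicator {0<..<1} a" for a b
  proof -
    obtain j where j: "k = Suc j" using k by (cases k) auto
    have "0 \<le> beta_k k ((a + b + real k) / 2)" "2 ^ k * beta_k k ((a + b + real k) / 2) \<le> M"
      if "a \<in> {0<..<1}" "b \<in> {0<..<1}"
      unfolding j M_def by (rule beta_k_bounds; use that in simp)+
    thus "0 \<le> g b a" "g b a \<le> M * indicator {0<..<1} b * indicator {0<..<1} a"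
      by (auto simp: g_def indicator_def simp del: beta_k.simps)
  qed
  have gm [measurable]: "(\<lambda>a. g b a) \<in> borel_measurable borel" "(\<lambda>(b, a). g b a) \<in> borel_measurable (borel \<Otimes>\<^sub>M borel)" for b
    unfolding g_def by measurable
  have M: "M \<ge> 0"
  proof -
    from g(2)[of "1/2" "1/2"] g(1)[of "1/2" "1/2"] show ?thesis by simp
  qed
  \<comment> \<open>Boundedness of the integrand makes the iterated nonnegative integrals finite, so that they
    agree with the iterated Lebesgue integrals.\<close>
  have i1: "integrable lborel (\<lambda>a. g b a)" for b
  proof (rule Bochner_Integration.integrable_bound)
    show "integrable lborel (\<lambda>a. M * indicator {0<..<1::real} a :: real)"
      by (intro integrable_mult_right integrable_real_indicator) auto
    show "AE a in lborel. norm (g b a) \<le> norm (M * indicator {0<..<1::real} a :: real)"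
    proof (rule AE_I2)
      fix a
      have "g b a \<le> M * indicator {0<..<1} b * indicator {0<..<1} a" by (rule g)
      also have "\<dots> \<le> M * indicator {0<..<1} a" using M by (simp add: indicator_def)
      finally show "norm (g b a) \<le> norm (M * indicator {0<..<1::real} a :: real)"
        using g(1)[of b a] M by (simp add: abs_mult)
    qed
  qed measurable
  define h where "h = (\<lambda>b. \<integral>a. g b a \<partial>lborel)"
  have h0: "h b \<ge> 0" for b unfolding h_def using g by (intro Bochner_Integration.integral_nonneg) auto
  have hM: "h b \<le> M * indicator {0<..<1} b" for b
  proof -
    have "h b \<le> (\<integral>a. M * indicator {0<..<1} b * indicator {0<..<1::real} a \<partial>lborel)"
      unfolding h_def using i1 g(2) by (intro integral_mono integrable_mult_right integrable_real_indicator) auto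
    thus ?thesis by simp
  qed
  have hm [measurable]: "h \<in> borel_measurable borel" unfolding h_def by measurable
  have i2: "integrable lborel h"
  proof (rule Bochner_Integration.integrable_bound)
    show "integrable lborel (\<lambda>a. M * indicator {0<..<1::real} a :: real)"
      by (intro integrable_mult_right integrable_real_indicator) auto
    show "AE b in lborel. norm (h b) \<le> norm (M * indicator {0<..<1::real} b :: real)"
      using h0 hM M by (intro AE_I2) (simp add: abs_mult)
  qed measurable
  have "(\<integral>\<^sup>+x. ennreal (indicator {0<..} x * (2 * sech_sq_kernel k x)) \<partial>lborel) =
     (\<integral>\<^sup>+b. (\<integral>\<^sup>+a. ennreal (g b a) \<partial>lborel) \<partial>lborel)"
    unfolding g_def by (rule nn_integral_sech_sq_kernel)
  also have "\<dots> = (\<integral>\<^sup>+b. ennreal (h b) \<partial>lborel)"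
    unfolding h_def using i1 g by (intro nn_integral_cong nn_integral_eq_integral) auto
  also have "\<dots> = ennreal (\<integral>b. h b \<partial>lborel)"
    using i2 h0 by (intro nn_integral_eq_integral) auto
  also have "(\<integral>b. h b \<partial>lborel) = (LBINT b=0..1. (LBINT a=0..1. 2 ^ k * beta_k k ((a + b + real k) / 2)))"
    unfolding h_def g_def by (rule LBINT_unit_square[symmetric])
  finally have "(\<integral>\<^sup>+x. ennreal (indicator {0<..} x * (2 * sech_sq_kernel k x)) \<partial>lborel) =
     ennreal (LBINT b=0..1. (LBINT a=0..1. 2 ^ k * beta_k k ((a + b + real k) / 2)))" (is "_ = ennreal ?R") .
  moreover have "?R \<ge> 0"
  proof -
    have "?R = (\<integral>b. h b \<partial>lborel)"
      unfolding h_def g_def by (rule LBINT_unit_square)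
    thus ?thesis using h0 by (simp add: Bochner_Integration.integral_nonneg)
  qed
  ultimately have "has_bochner_integral lborel (\<lambda>x. indicator {0<..} x * (2 * sech_sq_kernel k x)) ?R"
    by (intro has_bochner_integral_nn_integral) (auto simp: sech_sq_kernel_nonneg)
  hence "has_bochner_integral lborel (\<lambda>x. 1 / 2 * (indicator {0<..} x * (2 * sech_sq_kernel k x))) (1 / 2 * ?R)"
    by (intro has_bochner_integral_mult_right) auto
  thus ?thesis by simp
qed

section \<open>Catalan's constant\<close>

lemma summable_catalan: "summable (\<lambda>k. 1 / (2 * real k + 1)\<^sup>2)"
proof (rule summable_comparison_test)
  have "summable (\<lambda>n. inverse (real (Suc n) ^ 2))"
    by (subst summable_Suc_iff) (rule inverse_power_summable, simp)
  thus "summable (\<lambda>n. inverse (real (Suc n) ^ 2))" .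
  show "\<exists>N. \<forall>n\<ge>N. norm (1 / (2 * real n + 1)\<^sup>2) \<le> inverse (real (Suc n) ^ 2)"
    by (intro exI[of _ 0] allI impI) (auto simp: inverse_eq_divide intro!: divide_left_mono power_mono)
qed

definition catalan_coeff :: "nat \<Rightarrow> real" where
  "catalan_coeff k = (-1) ^ k / (2 * real k + 1)\<^sup>2"

text \<open>
  The inverse tangent integral \<open>\<integral>u in 0..t. arctan u / u\<close>, whose value at 1 is Catalan's constant. The
  power series in \<open>t\<^sup>2\<close> still converges absolutely at the endpoint, so continuity there is immediate.
\<close>

definition arctan_integral :: "real \<Rightarrow> real" where
  "arctan_integral t = t * (\<Sum>k. catalan_coeff k * (t\<^sup>2) ^ k)"

lemma norm_catalan_term_le:
  assumes "\<bar>u\<bar> \<le> 1"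
  shows "norm (catalan_coeff k * u ^ k) \<le> 1 / (2 * real k + 1)\<^sup>2"
proof -
  have "norm (catalan_coeff k * u ^ k) = 1 / (2 * real k + 1)\<^sup>2 * \<bar>u\<bar> ^ k"
    by (simp add: catalan_coeff_def abs_mult power_abs)
  also have "\<dots> \<le> 1 / (2 * real k + 1)\<^sup>2 * 1"
    using assms by (intro mult_left_mono power_le_one) auto
  finally show ?thesis by simp
qed

lemma summable_catalan_coeff: "\<bar>u\<bar> \<le> 1 \<Longrightarrow> summable (\<lambda>k. catalan_coeff k * u ^ k)"
  using norm_catalan_term_le by (blast intro: summable_comparison_test[OF _ summable_catalan])

text \<open>
  Differentiating \<open>t P(t\<^sup>2)\<close> multiplies the coefficient of index \<open>n\<close> by \<open>2 n + 1\<close>, which turns the series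
  into that of \<open>arctan t / t\<close>.
\<close>

lemma DERIV_arctan_integral:
  assumes t: "0 < t" "t < 1"
  shows "(arctan_integral has_real_derivative arctan t / t) (at t)"
proof -
  define u where "u = t\<^sup>2"
  define P where "P = (\<lambda>u. \<Sum>k. catalan_coeff k * u ^ k)"
  define P' where "P' = (\<Sum>k. diffs catalan_coeff k * u ^ k)"
  have u: "0 < u" "u < 1" using t by (auto simp: u_def power_less_one_iff)
  have P: "(P has_real_derivative P') (at u)"
    unfolding P_def P'_def using u by (intro termdiffs_strong'[of 1] summable_catalan_coeff) auto
  have "summable (\<lambda>k. diffs catalan_coeff k * u ^ k)"
    by (rule termdiff_converges[of _ 1]) (use u in \<open>auto intro!: summable_catalan_coeff\<close>)
  from diffs_equiv[OF this] have "(\<lambda>n. real n * catalan_coeff n * u ^ (n - Suc 0)) sums P'"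
    unfolding P'_def by simp
  hence "(\<lambda>n. 2 * u * (real n * catalan_coeff n * u ^ (n - Suc 0))) sums (2 * u * P')"
    by (rule sums_mult)
  moreover have "2 * u * (real n * catalan_coeff n * u ^ (n - Suc 0)) = 2 * real n * catalan_coeff n * u ^ n" for n
    by (cases n) auto
  ultimately have s1: "(\<lambda>n. 2 * real n * catalan_coeff n * u ^ n) sums (2 * u * P')" by simp
  have s2: "(\<lambda>n. catalan_coeff n * u ^ n) sums P u"
    unfolding P_def using u by (intro summable_sums summable_catalan_coeff) auto
  have "(\<lambda>n. t * (catalan_coeff n * u ^ n + 2 * real n * catalan_coeff n * u ^ n)) sums (t * (P u + 2 * u * P'))"
    by (intro sums_mult sums_add s1 s2)
  moreover have "t * (catalan_coeff n * u ^ n + 2 * real n * catalan_coeff n * u ^ n) =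
     (-1) ^ n * (1 / real (n * 2 + 1) * t ^ (n * 2 + 1))" for n
  proof -
    have "catalan_coeff n * (1 + 2 * real n) = (-1) ^ n / (1 + 2 * real n)"
      by (simp add: catalan_coeff_def power2_eq_square add_ac)
    moreover have "t * (catalan_coeff n * u ^ n + 2 * real n * catalan_coeff n * u ^ n) =
      t * u ^ n * (catalan_coeff n * (1 + 2 * real n))" by (simp add: algebra_simps)
    ultimately show ?thesis by (simp add: u_def mult_ac flip: power_mult)
  qed
  ultimately have "arctan t = t * (P u + 2 * u * P')"
    using arctan_series[of t] t by (simp add: sums_iff)
  hence eq: "arctan t / t = 1 * P u + (P' * (2 * t)) * t"
    using t by (simp add: u_def power2_eq_square)
  have "((\<lambda>t. t\<^sup>2) has_real_derivative 2 * t) (at t)" by (auto intro!: derivative_eq_intros)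
  from DERIV_chain2[OF P[unfolded u_def] this]
  have "((\<lambda>t. P (t\<^sup>2)) has_real_derivative P' * (2 * t)) (at t)" .
  from DERIV_mult[OF DERIV_ident this]
  show ?thesis unfolding eq by (simp add: arctan_integral_def[abs_def] P_def u_def)
qed

lemma continuous_on_arctan_integral: "continuous_on {0..1} arctan_integral"
proof -
  have "uniform_limit {0..1} (\<lambda>n t. \<Sum>k<n. catalan_coeff k * (t\<^sup>2) ^ k) (\<lambda>t. \<Sum>k. catalan_coeff k * (t\<^sup>2) ^ k) sequentially"
  proof (rule Weierstrass_m_test[OF _ summable_catalan])
    fix n and t :: real assume t: "t \<in> {0..1}"
    thus "norm (catalan_coeff n * (t\<^sup>2) ^ n) \<le> 1 / (2 * real n + 1)\<^sup>2"
      by (intro norm_catalan_term_le) (simp add: power_le_one)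
  qed
  hence "continuous_on {0..1} (\<lambda>t::real. \<Sum>k. catalan_coeff k * (t\<^sup>2) ^ k)"
    by (rule uniform_limit_theorem[rotated]) (auto intro!: continuous_intros always_eventually)
  thus ?thesis unfolding arctan_integral_def[abs_def] by (intro continuous_intros)
qed

text \<open>
  The substitution \<open>t = tan (pi (1 - r) / 4)\<close> turns the integral into \<open>4 / pi\<close> times that of
  \<open>arctan t / t\<close> over the unit interval.
\<close>

lemma has_bochner_integral_catalan:
  "has_bochner_integral lborel
     (\<lambda>r. indicator {0<..<1} r * ((1 - r) * (pi / (2 * sin (pi * ((1 - r) / 2)))))) (4 * Catalan_G / pi)"
proof -
  define \<theta> where "\<theta> = (\<lambda>r::real. pi / 4 * (1 - r))"
  define F where "F = (\<lambda>r. - (4 / pi) * arctan_integral (tan (\<theta> r)))"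
  have th: "0 \<le> \<theta> r" "\<theta> r \<le> pi / 4" if "r \<in> {0..1}" for r
    using that by (auto simp: \<theta>_def mult_left_le)
  have th': "0 < \<theta> r" "\<theta> r < pi / 4" if "0 < r" "r < 1" for r
    using that by (auto simp: \<theta>_def)
  have cpos: "cos (\<theta> r) > 0" if "r \<in> {0..1}" for r
    using th[OF that] pi_gt_zero by (intro cos_gt_zero_pi) linarith+
  have tan_bounds: "tan (\<theta> r) \<in> {0..1}" if "r \<in> {0..1}" for r
  proof -
    have "tan (\<theta> r) \<le> tan (pi / 4)"
      using th[OF that] pi_gt_zero by (intro tan_mono_le) linarith+
    moreover have "tan 0 \<le> tan (\<theta> r)"
      using th[OF that] pi_gt_zero by (intro tan_mono_le) linarith+
    ultimately show ?thesis by (simp add: tan_45)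
  qed
  have contF: "continuous_on {0..1} F"
  proof -
    have "continuous_on {0..1} (\<lambda>r. tan (\<theta> r))"
      using cpos unfolding \<theta>_def by (intro continuous_intros) (auto simp: less_le)
    hence "continuous_on {0..1} (\<lambda>r. arctan_integral (tan (\<theta> r)))"
      using tan_bounds by (intro continuous_on_compose2[OF continuous_on_arctan_integral]) auto
    thus ?thesis unfolding F_def by (intro continuous_intros)
  qed
  have "has_bochner_integral lborel
     (\<lambda>r. indicator {0<..<1} r * ((1 - r) * (pi / (2 * sin (pi * ((1 - r) / 2)))))) (F 1 - F 0)"
  proof (rule has_bochner_integral_FTC_01_nonneg)
    fix r :: real assume r: "0 < r" "r < 1"
    have s: "sin (\<theta> r) > 0" "cos (\<theta> r) > 0"
      using th'[OF r] pi_gt_zero cpos[of r] r by (auto intro!: sin_gt_zero)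
    have tan: "0 < tan (\<theta> r)" "tan (\<theta> r) < 1"
    proof -
      have "tan (\<theta> r) < tan (pi / 4)"
        using th'[OF r] pi_gt_zero by (intro tan_monotone) linarith+
      thus "tan (\<theta> r) < 1" by (simp add: tan_45)
      show "0 < tan (\<theta> r)" using s by (simp add: tan_def)
    qed
    have at: "arctan (tan (\<theta> r)) = \<theta> r"
      using th'[OF r] pi_gt_zero by (intro arctan_tan) linarith+
    have s2: "sin (pi * ((1 - r) / 2)) = 2 * sin (\<theta> r) * cos (\<theta> r)"
      unfolding sin_double[symmetric] by (simp add: \<theta>_def)
    have d1: "((\<lambda>r. tan (\<theta> r)) has_real_derivative inverse ((cos (\<theta> r))\<^sup>2) * (- (pi / 4))) (at r)"
      by (rule DERIV_chain2[OF DERIV_tan]) (use s in \<open>auto simp: \<theta>_def intro!: derivative_eq_intros\<close>)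
    have d2: "(F has_real_derivative - (4 / pi) * (arctan (tan (\<theta> r)) / tan (\<theta> r) * (inverse ((cos (\<theta> r))\<^sup>2) * (- (pi / 4))))) (at r)"
      unfolding F_def by (intro DERIV_cmult DERIV_chain2[OF DERIV_arctan_integral d1] tan)
    have eq: "- (4 / pi) * (arctan (tan (\<theta> r)) / tan (\<theta> r) * (inverse ((cos (\<theta> r))\<^sup>2) * (- (pi / 4)))) =
      (1 - r) * (pi / (2 * sin (pi * ((1 - r) / 2))))"
    proof -
      have "(1 - r) * pi = 4 * \<theta> r" by (simp add: \<theta>_def)
      hence "(1 - r) * (pi / (2 * sin (pi * ((1 - r) / 2)))) = \<theta> r / (sin (\<theta> r) * cos (\<theta> r))"
        unfolding s2 unfolding times_divide_eq_right by simp
      thus ?thesis unfolding at using s by (simp add: tan_def power2_eq_square field_simps)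
    qed
    show "(F has_real_derivative (1 - r) * (pi / (2 * sin (pi * ((1 - r) / 2))))) (at r)"
      using d2 unfolding eq .
    have sp: "sin (pi * ((1 - r) / 2)) > 0" unfolding s2 using s by simp
    show "isCont (\<lambda>r. (1 - r) * (pi / (2 * sin (pi * ((1 - r) / 2))))) r"
      using sp by (intro continuous_intros) auto
    show "0 \<le> (1 - r) * (pi / (2 * sin (pi * ((1 - r) / 2))))"
      using sp r by simp
  next
    show "(F \<longlongrightarrow> F 0) (at_right 0)"
      using continuous_on_Icc_at_rightD[OF contF] by simp
    show "(F \<longlongrightarrow> F 1) (at_left 1)"
      using continuous_on_Icc_at_leftD[OF contF] by simp
  qed
  moreover have "F 1 = 0" by (simp add: F_def \<theta>_def arctan_integral_def)
  moreover have "F 0 = - (4 * Catalan_G / pi)"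
    by (simp add: F_def \<theta>_def tan_45 arctan_integral_def catalan_coeff_def Catalan_G_def)
  ultimately show ?thesis by simp
qed

lemma catalan_integrand_nonneg:
  "0 \<le> indicator {0<..<1} r * ((1 - r) * (pi / (2 * sin (pi * ((1 - r) / 2)))))" for r :: real
proof (cases "r \<in> {0<..<1}")
  case True
  hence "sin (pi * ((1 - r) / 2)) > 0" by (intro sin_gt_zero) auto
  thus ?thesis using True by simp
qed auto

text \<open>
  Taylor's formula for \<open>cosh\<close> at 0 with integral remainder.
\<close>

lemma nn_integral_cosh_taylor:
  fixes x :: real
  assumes x: "x > 0"
  shows "(\<integral>\<^sup>+r. ennreal (indicator {0<..<1} r * ((1 - r) * cosh (r * x))) \<partial>lborel) = ennreal ((cosh x - 1) / x\<^sup>2)"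
proof -
  let ?F = "\<lambda>r. (1 - r) * sinh (r * x) / x + cosh (r * x) / x\<^sup>2"
  have "has_bochner_integral lborel (\<lambda>r. indicator {0<..<1} r * ((1 - r) * cosh (r * x))) (?F 1 - ?F 0)"
  proof (rule has_bochner_integral_FTC_01_nonneg)
    show "(?F has_real_derivative (1 - r) * cosh (r * x)) (at r)" for r
      using x by (auto intro!: derivative_eq_intros simp: field_simps power2_eq_square)
    show "isCont (\<lambda>r. (1 - r) * cosh (r * x)) r" for r by (intro continuous_intros)
    show "(?F \<longlongrightarrow> ?F 0) (at_right 0)" "(?F \<longlongrightarrow> ?F 1) (at_left 1)"
      by (rule tendsto_at_right_cont tendsto_at_left_cont, use x in \<open>intro continuous_intros; simp\<close>)+
    show "0 \<le> (1 - r) * cosh (r * x)" if "r < 1" for r using that by (simp add: less_imp_le)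
  qed
  moreover have "?F 1 - ?F 0 = (cosh x - 1) / x\<^sup>2" by (simp add: diff_divide_distrib)
  ultimately show ?thesis
    by (subst nn_integral_eq_integral) (auto simp: has_bochner_integral_iff indicator_def less_imp_le)
qed

text \<open>
  Splitting \<open>cosh\<close> into exponentials gives \<open>alt_beta\<close> at two points with sum 1, so the reflection formula
  applies.
\<close>

lemma has_bochner_integral_cosh_sech:
  assumes r: "0 < r" "r < 1"
  shows "has_bochner_integral lborel (\<lambda>x. indicator {0<..} x * (cosh (r * x) * sech x))
     (pi / (2 * sin (pi * ((1 - r) / 2))))"
proof -
  have "has_bochner_integral lborel (\<lambda>x. 1 / 2 * (indicator {0<..} x * (exp (-((1 - r)-1)*x) * sech x)
      + indicator {0<..} x * (exp (-((1 + r)-1)*x) * sech x)))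
     (1 / 2 * (alt_beta ((1 - r) / 2) + alt_beta ((1 + r) / 2)))"
    using r by (intro has_bochner_integral_mult_right has_bochner_integral_add has_bochner_integral_sech_beta) auto
  moreover have "1 / 2 * (indicator {0<..} x * (exp (-((1 - r)-1)*x) * sech x)
      + indicator {0<..} x * (exp (-((1 + r)-1)*x) * sech x)) = indicator {0<..} x * (cosh (r * x) * sech x)" for x
    by (simp add: cosh_def algebra_simps)
  moreover have "1 / 2 * (alt_beta ((1 - r) / 2) + alt_beta ((1 + r) / 2)) = pi / (2 * sin (pi * ((1 - r) / 2)))"
  proof -
    have eq: "1 - (1 - r) / 2 = (1 + r) / 2" by (simp add: field_simps)
    have "alt_beta ((1 - r) / 2) + alt_beta (1 - (1 - r) / 2) = pi / sin (pi * ((1 - r) / 2))"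
      using r by (intro alt_beta_reflection) auto
    thus ?thesis unfolding eq by simp
  qed
  ultimately show ?thesis by (simp only:)
qed

text \<open>
  For \<open>k = 0\<close> a one-dimensional average is more convenient than the one over the unit square: by
  Taylor's formula the kernel is an average of \<open>cosh (r x) * sech x\<close>, each of which integrates to an
  elementary function of \<open>r\<close>.
\<close>

lemma has_bochner_integral_sech_sq_kernel_0:
  "has_bochner_integral lborel (\<lambda>x. indicator {0<..} x * sech_sq_kernel 0 x) (4 * Catalan_G / pi)"
proof -
  define f :: "real \<Rightarrow> real \<Rightarrow> real" where
    "f = (\<lambda>x r. indicator {0<..} x * sech x * (indicator {0<..<1} r * ((1 - r) * cosh (r * x))))"
  define w where "w = (\<lambda>r::real. indicator {0<..<1} r * (1 - r) :: real)"
  have w: "w r \<ge> 0" for r by (simp add: w_def indicator_def)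
  have "(\<integral>\<^sup>+x. ennreal (indicator {0<..} x * sech_sq_kernel 0 x) \<partial>lborel) =
     (\<integral>\<^sup>+x. (\<integral>\<^sup>+r. ennreal (f x r) \<partial>lborel) \<partial>lborel)"
  proof (rule nn_integral_cong)
    fix x :: real
    show "ennreal (indicator {0<..} x * sech_sq_kernel 0 x) = (\<integral>\<^sup>+r. ennreal (f x r) \<partial>lborel)"
    proof (cases "x > 0")
      case True
      have S: "sech x \<ge> 0" by (simp add: less_imp_le)
      have "(\<integral>\<^sup>+r. ennreal (f x r) \<partial>lborel) =
        (\<integral>\<^sup>+r. ennreal (sech x) * ennreal (indicator {0<..<1} r * ((1 - r) * cosh (r * x))) \<partial>lborel)"
      proof -
        have "f x r = sech x * (indicator {0<..<1} r * ((1 - r) * cosh (r * x)))" for r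
          using True by (simp add: f_def)
        thus ?thesis by (simp only: ennreal_mult'[OF S])
      qed
      also have "\<dots> = ennreal (sech x) * (\<integral>\<^sup>+r. ennreal (indicator {0<..<1} r * ((1 - r) * cosh (r * x))) \<partial>lborel)"
        by (rule nn_integral_cmult) (unfold cosh_def, measurable)
      also have "\<dots> = ennreal (sech x * ((cosh x - 1) / x\<^sup>2))"
        by (simp only: nn_integral_cosh_taylor[OF True] ennreal_mult'[OF S])
      also have "sech x * ((cosh x - 1) / x\<^sup>2) = indicator {0<..} x * sech_sq_kernel 0 x"
        using True by (simp add: sech_sq_kernel_def)
      finally show ?thesis ..
    qed (simp add: f_def)
  qed
  also have "\<dots> = (\<integral>\<^sup>+r. (\<integral>\<^sup>+x. ennreal (f x r) \<partial>lborel) \<partial>lborel)"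
    by (rule lborel_pair.Fubini') (unfold f_def cosh_def, measurable)
  also have "\<dots> = (\<integral>\<^sup>+r. ennreal (indicator {0<..<1} r * ((1 - r) * (pi / (2 * sin (pi * ((1 - r) / 2)))))) \<partial>lborel)"
  proof (rule nn_integral_cong)
    fix r :: real
    show "(\<integral>\<^sup>+x. ennreal (f x r) \<partial>lborel) = ennreal (indicator {0<..<1} r * ((1 - r) * (pi / (2 * sin (pi * ((1 - r) / 2))))))"
    proof (cases "r \<in> {0<..<1}")
      case True
      have "has_bochner_integral lborel (\<lambda>x. w r * (indicator {0<..} x * (cosh (r * x) * sech x)))
         (w r * (pi / (2 * sin (pi * ((1 - r) / 2)))))"
        using True by (intro has_bochner_integral_mult_right has_bochner_integral_cosh_sech) auto
      moreover have "w r * (indicator {0<..} x * (cosh (r * x) * sech x)) = f x r" for x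
        by (simp add: w_def f_def)
      ultimately have "has_bochner_integral lborel (\<lambda>x. f x r) (w r * (pi / (2 * sin (pi * ((1 - r) / 2)))))"
        by simp
      moreover have "f x r \<ge> 0" for x using True by (simp add: f_def less_imp_le)
      ultimately show ?thesis
        by (subst nn_integral_eq_integral) (auto simp: has_bochner_integral_iff w_def mult.assoc)
    qed (auto simp: f_def)
  qed
  also have "\<dots> = ennreal (4 * Catalan_G / pi)"
  proof -
    show ?thesis using has_bochner_integral_catalan catalan_integrand_nonneg
      by (subst nn_integral_eq_integral) (auto simp: has_bochner_integral_iff)
  qed
  finally have "(\<integral>\<^sup>+x. ennreal (indicator {0<..} x * sech_sq_kernel 0 x) \<partial>lborel) = ennreal (4 * Catalan_G / pi)" .
  moreover have "4 * Catalan_G / pi \<ge> 0"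
  proof -
    have "0 \<le> (\<integral>r. indicator {0<..<1} r * ((1 - r) * (pi / (2 * sin (pi * ((1 - r) / 2))))) \<partial>lborel)"
      by (rule Bochner_Integration.integral_nonneg) (rule catalan_integrand_nonneg)
    thus ?thesis using has_bochner_integral_catalan by (simp add: has_bochner_integral_iff)
  qed
  ultimately show ?thesis
    by (intro has_bochner_integral_nn_integral) (auto simp: sech_sq_kernel_nonneg)
qed

section \<open>The logarithmic integrals\<close>

text \<open>
  The dominating function is \<open>- ln x\<close> near 0 plus \<open>2 x exp (-x)\<close>, both with explicit antiderivatives.
\<close>

lemma integrable_ln_sech_power:
  assumes m: "m \<ge> 1"
  shows "integrable lborel (\<lambda>x. indicator {0<..} x * (ln x * sech x ^ m))"
proof (rule Bochner_Integration.integrable_bound)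
  have "has_bochner_integral lborel (\<lambda>x::real. indicator {0<..<1} x * (- ln x)) ((1 - 1 * ln 1) - 0)"
  proof (rule has_bochner_integral_FTC_01_nonneg[where F = "\<lambda>x. x - x * ln x"])
    show "((\<lambda>x. x - x * ln x) has_real_derivative - ln x) (at x)" if "0 < x" for x :: real
      using that by (auto intro!: derivative_eq_intros)
    show "isCont (\<lambda>x. - ln x) x" if "0 < x" for x :: real
      using that by (intro continuous_intros) auto
    show "((\<lambda>x::real. x - x * ln x) \<longlongrightarrow> 0) (at_right 0)" by real_asymp
    show "((\<lambda>x::real. x - x * ln x) \<longlongrightarrow> 1 - 1 * ln 1) (at_left 1)"
      by (rule tendsto_at_left_cont) (intro continuous_intros, auto)
  qed auto
  moreover have "has_bochner_integral lborel (\<lambda>x::real. indicator {0<..} x * (2 * x * exp (-x))) (0 - (- 2))"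
  proof (rule has_bochner_integral_FTC_Ioi_nonneg[where F = "\<lambda>x. - 2 * (x + 1) * exp (-x)"])
    show "((\<lambda>x. - 2 * (x + 1) * exp (-x)) has_real_derivative 2 * x * exp (-x)) (at x)" for x :: real
      by (auto intro!: derivative_eq_intros simp: algebra_simps)
    show "isCont (\<lambda>x. 2 * x * exp (-x)) x" for x :: real by (intro continuous_intros)
    show "((\<lambda>x::real. - 2 * (x + 1) * exp (-x)) \<longlongrightarrow> -2) (at_right 0)" by real_asymp
    show "((\<lambda>x::real. - 2 * (x + 1) * exp (-x)) \<longlongrightarrow> 0) at_top" by real_asymp
  qed auto
  ultimately show "integrable lborel (\<lambda>x::real. indicator {0<..<1} x * (- ln x) + indicator {0<..} x * (2 * x * exp (-x)))"
    by (auto simp: has_bochner_integral_iff)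
  show "AE x in lborel. norm (indicator {0<..} x * (ln x * sech x ^ m)) \<le>
     norm (indicator {0<..<1} x * (- ln x) + indicator {0<..} x * (2 * x * exp (-x)))"
  proof (rule AE_I2)
    fix x :: real
    have S: "0 < sech x ^ m" "sech x ^ m \<le> sech x" using sech_power_le[OF m] by auto
    consider "x \<le> 0" | "0 < x" "x < 1" | "x \<ge> 1" by linarith
    thus "norm (indicator {0<..} x * (ln x * sech x ^ m)) \<le>
     norm (indicator {0<..<1} x * (- ln x) + indicator {0<..} x * (2 * x * exp (-x)))"
    proof cases
      case 2
      have "sech x ^ m \<le> 1" using S sech_le_1[of x] by linarith
      hence "\<bar>ln x\<bar> * sech x ^ m \<le> \<bar>ln x\<bar> * 1" by (intro mult_left_mono) auto
      moreover have "ln x < 0" using 2 by simp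
      moreover have "0 < 2 * x * exp (-x)" using 2 by simp
      moreover have "norm (indicator {0<..} x * (ln x * sech x ^ m)) = \<bar>ln x\<bar> * sech x ^ m"
        using 2 abs_of_pos[OF S(1)] by (simp add: abs_mult)
      moreover have "indicator {0<..<1} x * (- ln x) + indicator {0<..} x * (2 * x * exp (-x)) = - ln x + 2 * x * exp (-x)"
        using 2 by simp
      ultimately show ?thesis unfolding real_norm_def by linarith
    next
      case 3
      have "sech x ^ m \<le> 2 * exp (-x)" using S sech_le[of x] by linarith
      moreover have "0 \<le> ln x" "ln x \<le> x" using 3 ln_le_minus_one[of x] by auto
      ultimately have "ln x * sech x ^ m \<le> x * (2 * exp (-x))" using S 3 by (intro mult_mono) auto
      thus ?thesis using 3 S \<open>0 \<le> ln x\<close> by (simp add: abs_mult mult_ac)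
    qed auto
  qed
qed measurable

lemma Delta_eq_integral: "Delta n = (\<integral>x. indicator {0<..} x * (ln x * sech x ^ n) \<partial>lborel)"
  by (simp add: Delta_def interval_lebesgue_integral_def set_lebesgue_integral_def einterval_0_inf)

text \<open>
  Since \<open>(sech^m)'' = m\<^sup>2 sech^m - m (m + 1) sech^(m + 2)\<close>, the left-hand side is the integral of \<open>ln\<close> times
  this second derivative. Integrating by parts twice moves both derivatives to the logarithm and gives
  the integral of \<open>(1 - sech^m) / x\<^sup>2\<close>; the constant 1 is chosen so that the boundary term at 0
  vanishes.
\<close>

lemma Delta_recurrence:
  assumes m: "m \<ge> 1"
    and L: "\<And>k. k < m \<Longrightarrow> has_bochner_integral lborel (\<lambda>x. indicator {0<..} x * sech_sq_kernel k x) (L k)"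
  shows "(real m)\<^sup>2 * Delta m - real m * (real m + 1) * Delta (m + 2) = (\<Sum>k<m. L k)"
proof -
  define S where "S = (\<lambda>x. sech x ^ m)"
  \<comment> \<open>The terms \<open>tanh x * S x / x\<close> arising from the two summands cancel in the derivative.\<close>
  define F where "F = (\<lambda>x. ln x * (- real m * tanh x * S x) + (1 - S x) / x)"
  define f where "f = (\<lambda>x. ln x * ((real m)\<^sup>2 * sech x ^ m - real m * (real m + 1) * sech x ^ (m + 2)) - (1 - S x) / x\<^sup>2)"
  have dS: "(S has_real_derivative - real m * tanh x * S x) (at x)" for x
    unfolding S_def by (rule DERIV_sech_power)
  have dF: "(F has_real_derivative f x) (at x)" if x: "x > 0" for x
  proof -
    have dt: "(tanh has_real_derivative (sech x)\<^sup>2) (at x)"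
      using has_field_derivative_tanh[OF _ DERIV_ident, of x UNIV] cosh_real_pos[of x]
      by (simp add: one_minus_tanh_square)
    have d1: "((\<lambda>x. - real m * tanh x * S x) has_real_derivative
        (real m)\<^sup>2 * sech x ^ m - real m * (real m + 1) * sech x ^ (m + 2)) (at x)"
    proof -
      have "((\<lambda>x. - real m * tanh x * S x) has_real_derivative
         - real m * (sech x)\<^sup>2 * S x + (- real m * tanh x * S x) * (- real m * tanh x)) (at x)"
        using DERIV_mult[OF DERIV_cmult[OF dt, of "- real m"] dS] by (simp add: mult_ac)
      moreover have "- real m * (sech x)\<^sup>2 * S x + (- real m * tanh x * S x) * (- real m * tanh x) =
        - real m * (sech x)\<^sup>2 * S x + (real m)\<^sup>2 * S x * (tanh x)\<^sup>2" by (simp add: power2_eq_square)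
      moreover have "(tanh x)\<^sup>2 = 1 - (sech x)\<^sup>2" using one_minus_tanh_square[of x] by simp
      moreover have "- real m * (sech x)\<^sup>2 * S x + (real m)\<^sup>2 * S x * (1 - (sech x)\<^sup>2) =
        (real m)\<^sup>2 * sech x ^ m - real m * (real m + 1) * sech x ^ (m + 2)"
        by (simp add: S_def power_add algebra_simps power2_eq_square)
      ultimately show ?thesis by (simp only:)
    qed
    have d2: "((\<lambda>x. (1 - S x) / x) has_real_derivative (real m * tanh x * S x * x - (1 - S x)) / x\<^sup>2) (at x)"
      using x by (auto intro!: derivative_eq_intros dS simp: power2_eq_square)
    have d3: "(ln has_real_derivative 1 / x) (at x)" using x by (auto intro!: derivative_eq_intros)
    from DERIV_add[OF DERIV_mult[OF d3 d1] d2] show ?thesis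
      unfolding F_def f_def
      by (rule DERIV_cong) (use x in \<open>simp add: field_simps power2_eq_square\<close>)
  qed
  have cf: "isCont f x" if x: "x > 0" for x
    unfolding f_def S_def using x by (intro continuous_intros) auto
  have int: "has_bochner_integral lborel (\<lambda>x. indicator {0<..} x * f x)
     (((real m)\<^sup>2 * Delta m - real m * (real m + 1) * Delta (m + 2)) - (\<Sum>k<m. L k))"
  proof -
    have D: "has_bochner_integral lborel (\<lambda>x. indicator {0<..} x * (ln x * sech x ^ j)) (Delta j)" if "j \<ge> 1" for j
      using integrable_ln_sech_power[OF that] by (simp add: has_bochner_integral_iff Delta_eq_integral)
    have "has_bochner_integral lborel (\<lambda>x. (real m)\<^sup>2 * (indicator {0<..} x * (ln x * sech x ^ m))
        - real m * (real m + 1) * (indicator {0<..} x * (ln x * sech x ^ (m + 2)))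
        - (\<Sum>k<m. indicator {0<..} x * sech_sq_kernel k x))
     (((real m)\<^sup>2 * Delta m - real m * (real m + 1) * Delta (m + 2)) - (\<Sum>k<m. L k))"
      using m by (intro has_bochner_integral_diff has_bochner_integral_mult_right has_bochner_integral_sum D L) auto
    moreover have "(real m)\<^sup>2 * (indicator {0<..} x * (ln x * sech x ^ m))
        - real m * (real m + 1) * (indicator {0<..} x * (ln x * sech x ^ (m + 2)))
        - (\<Sum>k<m. indicator {0<..} x * sech_sq_kernel k x) = indicator {0<..} x * f x" for x
      unfolding sum_distrib_left[symmetric] sum_sech_sq_kernel by (simp add: f_def S_def algebra_simps)
    ultimately show ?thesis by simp
  qed
  have "(\<integral>x. indicator {0<..} x * f x \<partial>lborel) = 0 - 0"
  proof (rule integral_FTC_Ioi[OF dF cf])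
    show "integrable lborel (\<lambda>x. indicator {0<..} x * f x)" using int by (simp add: has_bochner_integral_iff)
    \<comment> \<open>At 0 the logarithm is compensated by \<open>tanh x \<sim> x\<close>, and the second summand is minus the difference
      quotient of \<open>S\<close>, whose derivative vanishes there.\<close>
    have t0: "((\<lambda>x. tanh x / x) \<longlongrightarrow> 1) (at_right (0::real))"
    proof -
      have "(tanh has_real_derivative 1) (at (0::real))"
        using has_field_derivative_tanh[OF _ DERIV_ident, of "0::real" UNIV] by simp
      hence "((\<lambda>x. tanh x / x) \<longlongrightarrow> 1) (at (0::real))" by (simp add: has_field_derivative_iff)
      thus ?thesis by (rule filterlim_mono) (auto intro: at_le)
    qed
    have S0: "((\<lambda>x. (1 - S x) / x) \<longlongrightarrow> - 0) (at_right 0)"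
    proof -
      have "(S has_real_derivative 0) (at 0)" using dS[of 0] by simp
      moreover have "S 0 = 1" by (simp add: S_def sech_def)
      ultimately have "((\<lambda>x. (S x - 1) / x) \<longlongrightarrow> 0) (at 0)" by (simp add: has_field_derivative_iff)
      hence "((\<lambda>x. (S x - 1) / x) \<longlongrightarrow> 0) (at_right 0)" by (rule filterlim_mono) (auto intro: at_le)
      from tendsto_minus[OF this] show ?thesis by (simp add: minus_divide_left)
    qed
    have S1: "(S \<longlongrightarrow> S 0) (at_right 0)" using dS[of 0] by (intro tendsto_at_right_cont DERIV_isCont)
    have "((\<lambda>x::real. x * ln x) \<longlongrightarrow> 0) (at_right 0)" by real_asymp
    hence "((\<lambda>x. - real m * (x * ln x) * (tanh x / x) * S x + (1 - S x) / x) \<longlongrightarrow> - real m * 0 * 1 * S 0 + - 0) (at_right 0)"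
      by (intro tendsto_intros t0 S0 S1)
    moreover have "\<forall>\<^sub>F x in at_right 0. - real m * (x * ln x) * (tanh x / x) * S x + (1 - S x) / x = F x"
      using eventually_at_right_less[of 0] by eventually_elim (simp add: F_def)
    ultimately show "(F \<longlongrightarrow> 0) (at_right 0)" by (simp add: filterlim_cong)
    show "(F \<longlongrightarrow> 0) at_top"
    proof (rule Lim_null_comparison)
      have "((\<lambda>x::real. real m * (x * (2 * exp (- x))) + 1 / x) \<longlongrightarrow> real m * 0 + 0) at_top"
        by (intro tendsto_intros) (real_asymp+)
      thus "((\<lambda>x::real. real m * (x * (2 * exp (- x))) + 1 / x) \<longlongrightarrow> 0) at_top" by simp
      show "\<forall>\<^sub>F x in at_top. norm (F x) \<le> real m * (x * (2 * exp (- x))) + 1 / x"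
        using eventually_ge_at_top[of 1]
      proof eventually_elim
        case (elim x)
        have Sx: "0 < S x" "S x \<le> 1" "S x \<le> 2 * exp (- x)"
          using sech_power_le[OF m, of x] sech_le[of x] sech_le_1[of x] by (auto simp: S_def)
        have l: "0 \<le> ln x" "ln x \<le> x" using elim ln_le_minus_one[of x] by auto
        have t: "0 \<le> tanh x" "tanh x \<le> 1" using elim tanh_real_lt_1[of x] by (auto intro: less_imp_le)
        have "ln x * (tanh x * S x) \<le> x * (1 * (2 * exp (- x)))"
          using l t Sx elim by (intro mult_mono) auto
        hence "real m * (ln x * (tanh x * S x)) \<le> real m * (x * (2 * exp (- x)))"
          by (intro mult_left_mono) auto
        moreover have "\<bar>ln x * (- real m * tanh x * S x)\<bar> = real m * (ln x * (tanh x * S x))"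
          using l t Sx by (simp add: abs_mult)
        moreover have "\<bar>(1 - S x) / x\<bar> \<le> 1 / x"
          using Sx elim by (simp add: divide_right_mono)
        ultimately show ?case unfolding F_def real_norm_def by linarith
      qed
    qed
  qed
  with int show ?thesis by (simp add: has_bochner_integral_iff)
qed

section \<open>The parametric integrand\<close>

text \<open>
  The digamma expression is a multiple of \<open>beta_k\<close> at \<open>p = (a + b + k) / 2\<close>, by the closed form. For
  \<open>a + b > 0\<close> it is therefore minus half the moment of \<open>sech^(k + 1)\<close> at \<open>s = a + b\<close>.
\<close>

lemma integrand_ext_eq:
  assumes ab: "a + b \<notin> \<int>"
  shows "integrand_ext k (a, b) = - (1 / 2) * (2 ^ k * beta_k k ((a + b + real k) / 2))"
proof -
  \<comment> \<open>Every excluded value of a digamma argument, and every pole met in the closed form, forces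
    \<open>a + b\<close> to be an integer.\<close>
  have nI: "a + b \<in> \<int>" if "(a + b - of_int i) / of_nat (Suc j) \<in> \<int>\<^sub>\<le>\<^sub>0" for i j
  proof -
    from that obtain z where "(a + b - of_int i) / of_nat (Suc j) = of_int z" by (auto simp: nonpos_Ints_def)
    hence "a + b = of_int (z * int (Suc j) + i)" by (simp add: field_simps)
    thus ?thesis by (metis Ints_of_int)
  qed
  have "(a, b) \<in> digamma_dom k"
    using nI[of "int k" 3] nI[of "int k - 2" 3] ab by (auto simp: digamma_dom_def algebra_simps)
  hence "integrand_ext k (a, b) = integrand k (a, b)" by (simp add: integrand_ext_def)
  also have "\<dots> = - (2 ^ k / 2) * beta_k k ((a + b + real k) / 2)"
  proof -
    define p where "p = (a + b + real k) / 2"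
    have eq: "(a + b + real k) / 2 = p" "(a + b + real k - 2 * real j) / 2 = p - real j"
      "(a + b - real k) / 2 = p - real k" "(a + b - real k) / 4 = (p - real k) / 2"
      "(a + b - real k + 2) / 4 = (p - real k + 1) / 2" for j
      by (simp_all add: p_def field_simps)
    have "p - real k \<notin> \<int>\<^sub>\<le>\<^sub>0" using nI[of "int k" 1] ab unfolding eq(3)[symmetric] by auto
    from beta_k_closed_form[OF this] show ?thesis unfolding integrand_def prod.case eq .
  qed
  finally show ?thesis by simp
qed

text \<open>
  For fixed \<open>b\<close> the poles are met for countably many \<open>a\<close> only, so the values of the continuous
  extension do not affect the inner integral.
\<close>

lemma LBINT_integrand_ext:
  "(LBINT b=0..1. (LBINT a=0..1. integrand_ext k (a, b))) =
   - (1 / 2) * (LBINT b=0..1. (LBINT a=0..1. 2 ^ k * beta_k k ((a + b + real k) / 2)))"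
proof -
  define h where "h = (\<lambda>a b. 2 ^ k * beta_k k ((a + b + real k) / 2))"
  have zero_le_one_ereal: "(0::ereal) \<le> 1" by simp
  have "(LBINT a=0..1. integrand_ext k (a, b)) = - (1 / 2) * (LBINT a=0..1. h a b)" for b
  proof -
    have "(LBINT a=0..1. integrand_ext k (a, b)) = (LBINT a=0..1. - (1 / 2) * h a b)"
      unfolding interval_lebesgue_integral_def set_lebesgue_integral_def if_P[OF zero_le_one_ereal]
    proof (rule integral_discrete_difference)
      have "{a. a + b \<in> \<int>} = (\<lambda>z::real. z - b) ` \<int>" by (force simp: image_iff)
      thus "countable {a. a + b \<in> \<int>}" by (simp add: countable_int)
    qed (auto simp: integrand_ext_eq h_def)
    also have "\<dots> = - (1 / 2) * (LBINT a=0..1. h a b)"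
      by (rule interval_lebesgue_integral_mult_right)
    finally show ?thesis .
  qed
  hence "(LBINT b=0..1. (LBINT a=0..1. integrand_ext k (a, b))) = (LBINT b=0..1. - (1 / 2) * (LBINT a=0..1. h a b))"
    by simp
  also have "\<dots> = - (1 / 2) * (LBINT b=0..1. (LBINT a=0..1. h a b))"
    by (rule interval_lebesgue_integral_mult_right)
  finally show ?thesis unfolding h_def .
qed

theorem proposition1:
  fixes n :: nat
  assumes "n \<ge> 4"
  shows "Delta n =
    - (4 * Catalan_G) / (pi * (real n - 2) * (real n - 1))
    + (real n - 2) / (real n - 1) * Delta (n - 2)
    + 1 / ((real n - 2) * (real n - 1)) *
        (\<Sum>k = 1..n - 3. LBINT b=0..1. (LBINT a=0..1. integrand_ext k (a, b)))"
proof -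
  define m where "m = n - 2"
  have m: "m \<ge> 2" "n = m + 2" using assms by (auto simp: m_def)
  define J where "J = (\<lambda>k. LBINT b=0..1. (LBINT a=0..1. integrand_ext k (a, b)))"
  \<comment> \<open>The recurrence at \<open>m = n - 2\<close>: its summand for \<open>k = 0\<close> is the Catalan term.\<close>
  define L where "L = (\<lambda>k. if k = 0 then 4 * Catalan_G / pi else - J k)"
  have "has_bochner_integral lborel (\<lambda>x. indicator {0<..} x * sech_sq_kernel k x) (L k)" for k
    using has_bochner_integral_sech_sq_kernel_0 has_bochner_integral_sech_sq_kernel[of k]
    by (auto simp: L_def J_def LBINT_integrand_ext)
  hence "(real m)\<^sup>2 * Delta m - real m * (real m + 1) * Delta (m + 2) = (\<Sum>k<m. L k)"
    using m by (intro Delta_recurrence) auto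
  also have "{..<m} = insert 0 {1..n - 3}" using m by auto
  also have "(\<Sum>k\<in>insert 0 {1..n - 3}. L k) = 4 * Catalan_G / pi - (\<Sum>k = 1..n - 3. J k)"
    by (subst sum.insert) (auto simp: L_def sum_negf)
  finally have "(real m)\<^sup>2 * Delta m - real m * (real m + 1) * Delta (m + 2) = 4 * Catalan_G / pi - (\<Sum>k = 1..n - 3. J k)" .
  moreover define T where "T = (\<Sum>k = 1..n - 3. J k)"
  ultimately have "real m * (real m + 1) * Delta (m + 2) = (real m)\<^sup>2 * Delta m - 4 * Catalan_G / pi + T" by simp
  hence "Delta (m + 2) = ((real m)\<^sup>2 * Delta m - 4 * Catalan_G / pi + T) / (real m * (real m + 1))"
    using m by (simp add: eq_divide_eq mult_ac)
  also have "\<dots> = - (4 * Catalan_G) / (pi * real m * (real m + 1)) + real m / (real m + 1) * Delta m + 1 / (real m * (real m + 1)) * T"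
  proof -
    have "(r\<^sup>2 * D - g + T) / (r * (r + 1)) = - (g / (r * (r + 1))) + r / (r + 1) * D + 1 / (r * (r + 1)) * T"
      if "r > 0" for r D g :: real
      using that by (simp add: divide_simps power2_eq_square)
    from this[of "real m" "Delta m" "4 * Catalan_G / pi"] m show ?thesis by (simp add: mult_ac)
  qed
  finally show ?thesis using m by (simp add: T_def J_def add_ac)
qed

end
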